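(* Let $Q\subset\mathbb{R}^m$ be a closed set, let $\varphi:\mathbb{R}^n\to\mathbb{R}^m$ be twice continuously differentiable, let $C:=\varphi^{-1}(Q)$, and set $\beta(x'):=\nabla\varphi(x')$ and \[\Lambda(x',x'^* ):=\{\lambda\in N_Q(\varphi(x')) : \beta(x')^T\lambda=x'^*\}\qquad (x',x'^* )\in\mathbb{R}^n\times\mathbb{R}^n.\] Let $(x,x^* )\in\mathrm{gph}\,N_C$ and assume that the constraint mapping $M(x')=\varphi(x')-Q$ is metrically subregular at $(x,0)$. (i) If $Q$ is Clarke regular near $\varphi(x)$ (which is the case if $Q$ is convex), then $\Lambda$ is inner semicompact at $(x,x^* )$ with respect to its domain. (ii) If $Q$ is convex polyhedral, then $\Lambda$ is inner calm* at $(x,x^* )$ with respect to its domain in the fuzzy sense. (iii) Let $(u,u^* )\in\mathbb{R}^n\times\mathbb{R}^n$ be a unit vector. If $Q$ is convex polyhedral and the system $\varphi(\cdot)\in Q$ is non-degenerate at $x$ in direction $u$, i.e., \[\beta(x)^T\lambda=0,\ \ \lambda\in\mathrm{sp}\,N_{T_Q(\varphi(x))}(\nabla\varphi(x)u)\ \Longrightarrow\ \lambda=0,\] then $\Lambda$ is inner calm* at $(x,x^* )$ with respect to its domain in direction $(u,u^* )$.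
   Context: For a closed set $\Omega$ and $\bar z\in\Omega$: $T_\Omega(\bar z)$ is the tangent (Bouligand) cone $\{w:\exists t_k\downarrow0,\,w_k\to w,\ \bar z+t_kw_k\in\Omega\ \forall k\}$; $\widehat N_\Omega(\bar z)=T_\Omega(\bar z)^\circ$ (negative polar) is the regular normal cone; $N_\Omega(\bar z)=\{z^*:\exists z_k\to\bar z,\ z_k^*\to z^*,\ z_k^*\in\widehat N_\Omega(z_k)\}$ is the limiting normal cone. These sets are empty if $\bar z\notin\Omega$. $\Omega$ is Clarke regular at $\bar z$ if $\widehat N_\Omega(\bar z)=N_\Omega(\bar z)$. $\mathrm{sp}\,A$ is the linear hull of $A$. A convex polyhedral set is a finite intersection of halfspaces. $\nabla\varphi$ is the Jacobian. A set-valued map $M$ is metrically subregular at $(\bar x,\bar y)\in\mathrm{gph}\,M$ if there are $\kappa>0$ and a neighbourhood $U$ of $\bar x$ with $\mathrm{dist}(x,M^{-1}(\bar y))\le\kappa\,\mathrm{dist}(\bar y,M(x))$ for all $x\in U$. For a set-valued map $S:\mathbb{R}^p\rightrightarrows\mathbb{R}^q$ and $\Omega\subset\mathbb{R}^p$ (below "domain" is $\mathrm{dom}\,S=\{y:S(y)\ne\emptyset\}$): - a sequence $y_k$ converges to $\bar y$ from direction $v$ if $y_k=\bar y+t_kv_k$ for some $t_k\downarrow0$, $v_k\to v$; - $S$ is inner semicompact at $\bar y$ with respect to $\Omega$ if for every sequence $y_k\to\bar y$ with $y_k\in\Omega$ there exist an infinite $K\subset\mathbb{N}$ and $x_k\in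 S(y_k)$ ($k\in K$) converging to some $\bar x$; - $S$ is inner calm* at $\bar y$ with respect to $\Omega$ if there is $\kappa>0$ such that for every sequence $y_k\to\bar y$ with $y_k\in\Omega$ there exist an infinite $K\subset\mathbb{N}$, $x_k\in S(y_k)$ ($k\in K$) and $\bar x\in\mathbb{R}^q$ with $\|x_k-\bar x\|\le\kappa\|y_k-\bar y\|$ for $k\in K$; it is inner calm* in direction $v$ if this is required only for sequences $y_k\in\Omega$ converging to $\bar y$ from direction $v$; - $S$ is inner calm* at $\bar y$ in direction $v$ with respect to $\Omega$ in the fuzzy sense if either $v\notin T_\Omega(\bar y)$, or there exist $\kappa_v>0$, a sequence $y_k\in\Omega$ converging to $\bar y$ from $v$, $x_k\in S(y_k)$ and a point $\bar x$ with $\|x_k-\bar x\|\le\kappa_v\|y_k-\bar y\|$ for all $k$; it is inner calm* at $\bar y$ with respect to $\Omega$ in the fuzzy sense if this holds for every unit direction $v$. *)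

theory Defs
  imports "HOL-Analysis.Analysis"
begin

section \<open>Tangent and normal cones\<close>

text \<open>
  Here \<open>t\<^sub>k \<down> 0\<close> means \<open>t\<^sub>k > 0\<close> and \<open>t\<^sub>k \<rightarrow> 0\<close>; monotonicity is not required.
\<close>

definition converges_from_direction ::
    "(nat \<Rightarrow> 'a::real_normed_vector) \<Rightarrow> 'a \<Rightarrow> 'a \<Rightarrow> bool" where
  "converges_from_direction ys y v \<longleftrightarrow>
     (\<exists>t vs. (\<forall>k. 0 < t k) \<and> t \<longlonglongrightarrow> (0::real) \<and> vs \<longlonglongrightarrow> v \<and>
             (\<forall>k. ys k = y + t k *\<^sub>R vs k))"

text \<open>All three cones are empty at points outside of the set.\<close>

definition tangent_cone :: "'a::real_normed_vector set \<Rightarrow> 'a \<Rightarrow> 'a set" where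
  "tangent_cone \<Omega> z =
     {w. z \<in> \<Omega> \<and>
         (\<exists>t ws. (\<forall>k. 0 < t k) \<and> t \<longlonglongrightarrow> (0::real) \<and> ws \<longlonglongrightarrow> w \<and>
                 (\<forall>k::nat. z + t k *\<^sub>R ws k \<in> \<Omega>))}"

definition negative_polar :: "'a::real_inner set \<Rightarrow> 'a set" where
  "negative_polar K = {z'. \<forall>w\<in>K. z' \<bullet> w \<le> 0}"

definition regular_normal_cone :: "'a::real_inner set \<Rightarrow> 'a \<Rightarrow> 'a set" where
  "regular_normal_cone \<Omega> z = (if z \<in> \<Omega> then negative_polar (tangent_cone \<Omega> z) else {})"

definition limiting_normal_cone :: "'a::real_inner set \<Rightarrow> 'a \<Rightarrow> 'a set" where
  "limiting_normal_cone \<Omega> z =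
     {z'. z \<in> \<Omega> \<and>
          (\<exists>zs zs'. zs \<longlonglongrightarrow> z \<and> zs' \<longlonglongrightarrow> z' \<and>
                    (\<forall>k::nat. zs' k \<in> regular_normal_cone \<Omega> (zs k)))}"

definition clarke_regular_at :: "'a::real_inner set \<Rightarrow> 'a \<Rightarrow> bool" where
  "clarke_regular_at \<Omega> z \<longleftrightarrow> regular_normal_cone \<Omega> z = limiting_normal_cone \<Omega> z"

definition clarke_regular_near :: "'a::real_inner set \<Rightarrow> 'a \<Rightarrow> bool" where
  "clarke_regular_near \<Omega> z \<longleftrightarrow> (\<forall>\<^sub>F z' in nhds z. z' \<in> \<Omega> \<longrightarrow> clarke_regular_at \<Omega> z')"


section \<open>Set-valued maps\<close>

definition graph_of :: "('a \<Rightarrow> 'b set) \<Rightarrow> ('a \<times> 'b) set" where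
  "graph_of S = {(y, x). x \<in> S y}"

definition domain_of :: "('a \<Rightarrow> 'b set) \<Rightarrow> 'a set" where
  "domain_of S = {y. S y \<noteq> {}}"

text \<open>
  The guard \<open>M x' \<noteq> {}\<close> implements the convention that the distance to the empty set is
  infinite, whereas \<^const>\<open>infdist\<close> is \<open>0\<close> there. The set \<open>{z. y \<in> M z}\<close>, i.e. the preimage
  of \<open>y\<close> under \<open>M\<close>, contains \<open>x\<close>.
\<close>

definition metrically_subregular ::
    "('a::metric_space \<Rightarrow> 'b::metric_space set) \<Rightarrow> 'a \<Rightarrow> 'b \<Rightarrow> bool" where
  "metrically_subregular M x y \<longleftrightarrow>
     (x, y) \<in> graph_of M \<and>
     (\<exists>\<kappa>>0. \<exists>U. open U \<and> x \<in> U \<and>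
        (\<forall>x'\<in>U. M x' \<noteq> {} \<longrightarrow> infdist x' {z. y \<in> M z} \<le> \<kappa> * infdist y (M x')))"

text \<open>
  The infinite index set \<open>K\<close> is the range of a strictly increasing \<open>r\<close>, and the points
  \<open>x\<^sub>k\<close>, \<open>k \<in> K\<close>, are listed as \<open>xs j = x\<^sub>k\<close> with \<open>k = r j\<close>.
\<close>

definition inner_semicompact ::
    "('a::topological_space \<Rightarrow> 'b::topological_space set) \<Rightarrow> 'a \<Rightarrow> 'a set \<Rightarrow> bool" where
  "inner_semicompact S y \<Omega> \<longleftrightarrow>
     (\<forall>ys. ys \<longlonglongrightarrow> y \<and> (\<forall>k. ys k \<in> \<Omega>) \<longrightarrow>
        (\<exists>(r::nat \<Rightarrow> nat) xs x. strict_mono r \<and> (\<forall>j. xs j \<in> S (ys (r j))) \<and> xs \<longlonglongrightarrow> x))"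

definition inner_calm_star_dir ::
    "('a::real_normed_vector \<Rightarrow> 'b::real_normed_vector set) \<Rightarrow> 'a \<Rightarrow> 'a \<Rightarrow> 'a set \<Rightarrow> bool" where
  "inner_calm_star_dir S y v \<Omega> \<longleftrightarrow>
     (\<exists>\<kappa>>0. \<forall>ys. converges_from_direction ys y v \<and> (\<forall>k. ys k \<in> \<Omega>) \<longrightarrow>
        (\<exists>(r::nat \<Rightarrow> nat) xs x. strict_mono r \<and>
           (\<forall>j. xs j \<in> S (ys (r j)) \<and> norm (xs j - x) \<le> \<kappa> * norm (ys (r j) - y))))"

definition inner_calm_star_fuzzy_dir ::
    "('a::real_normed_vector \<Rightarrow> 'b::real_normed_vector set) \<Rightarrow> 'a \<Rightarrow> 'a \<Rightarrow> 'a set \<Rightarrow> bool" where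
  "inner_calm_star_fuzzy_dir S y v \<Omega> \<longleftrightarrow>
     v \<notin> tangent_cone \<Omega> y \<or>
     (\<exists>\<kappa>>0. \<exists>ys xs x. converges_from_direction ys y v \<and>
        (\<forall>k. ys k \<in> \<Omega> \<and> xs k \<in> S (ys k) \<and> norm (xs k - x) \<le> \<kappa> * norm (ys k - y)))"

definition inner_calm_star_fuzzy ::
    "('a::real_normed_vector \<Rightarrow> 'b::real_normed_vector set) \<Rightarrow> 'a \<Rightarrow> 'a set \<Rightarrow> bool" where
  "inner_calm_star_fuzzy S y \<Omega> \<longleftrightarrow>
     (\<forall>v. norm v = 1 \<longrightarrow> inner_calm_star_fuzzy_dir S y v \<Omega>)"


section \<open>Constraint systems\<close>

definition twice_continuously_differentiable ::
    "('a::real_normed_vector \<Rightarrow> 'b::real_normed_vector) \<Rightarrow> bool" where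
  "twice_continuously_differentiable f \<longleftrightarrow>
     (\<exists>(f' :: 'a \<Rightarrow> 'a \<Rightarrow>\<^sub>L 'b) (f'' :: 'a \<Rightarrow> 'a \<Rightarrow>\<^sub>L 'a \<Rightarrow>\<^sub>L 'b).
        (\<forall>x. (f has_derivative blinfun_apply (f' x)) (at x)) \<and>
        (\<forall>x. (f' has_derivative blinfun_apply (f'' x)) (at x)) \<and>
        continuous_on UNIV f'')"

definition constraint_mapping :: "('a \<Rightarrow> 'b::ab_group_add) \<Rightarrow> 'b set \<Rightarrow> 'a \<Rightarrow> 'b set" where
  "constraint_mapping \<phi> Q x = {\<phi> x - q | q. q \<in> Q}"

definition multiplier_map ::
    "(real^'n \<Rightarrow> real^'m) \<Rightarrow> (real^'m) set \<Rightarrow> (real^'n) \<times> (real^'n) \<Rightarrow> (real^'m) set" where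
  "multiplier_map \<phi> Q = (\<lambda>(x, x').
     {\<mu> \<in> limiting_normal_cone Q (\<phi> x). transpose (jacobian \<phi> (at x)) *v \<mu> = x'})"

end

theory Submission
  imports Defs
begin

text \<open>
  All three statements about multipliers rest on one estimate. If \<open>v\<close> is a regular normal to the
  preimage \<open>C\<close> of \<open>Q\<close> at \<open>z\<close>, then \<open>v \<bullet> (x - z) \<le> \<epsilon> * norm (x - z)\<close> for nearby \<open>x\<close> in \<open>C\<close>. Metric
  subregularity with modulus \<open>\<kappa>\<close> turns this into an inequality without constraint: for nearby \<open>x\<close> it
  fails by at most \<open>\<kappa> * (\<epsilon> + norm v)\<close> times the distance of \<open>\<phi> x\<close> to \<open>Q\<close>. The first-order conditions
  of a smoothed version of the resulting minimisation problem yield a multiplier of \<open>v\<close> whose norm is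
  bounded by \<open>\<kappa> * norm v\<close> up to \<open>\<epsilon>\<close>, and letting \<open>\<epsilon>\<close> tend to zero gives \<open>bounded_multiplier\<close>. The modulus
  is the same for all points near the reference point. As Clarke regularity makes every
  element of the domain of the multiplier map a regular normal to \<open>C\<close>, elements of the domain
  converging to \<open>(x, xs)\<close> have bounded, hence subconvergent, multipliers (\<open>convergent_multipliers\<close>). This is
  inner semicompactness.

  For polyhedral \<open>Q\<close> the normal cone at a point is generated by the active constraint vectors, so only
  finitely many cones occur. Let the multipliers \<open>\<mu> i\<close> of the points \<open>(x, xs) + t i *\<^sub>R us i\<close> converge
  to \<open>\<nu>\<close>, and let the superscript \<open>T\<close> denote transposes. Subtracting the equations for \<open>\<mu> i\<close> and \<open>\<nu>\<close> shows
  that \<open>(\<phi>' x)\<^sup>T (\<mu> i - \<nu>)\<close> is of order \<open>t i\<close>.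

  In a non-degenerate direction the transpose is injective on a subspace that contains all but finitely many \<open>\<mu> i - \<nu>\<close>,
  because only constraints that stay active to first order along the direction can be active
  at the approximating points. So \<open>\<mu> i - \<nu>\<close> is itself of order \<open>t i\<close>, with a constant that does not depend on
  the sequence.

  In a degenerate direction \<open>\<mu> i - \<nu>\<close> can be much larger than \<open>t i\<close>, but the fuzzy notion permits to change the
  sequence. The quotients \<open>(\<mu> i - \<nu>) / t i\<close> lie in the finitely generated cone of the directions pointing
  from \<open>\<nu>\<close> into the normal cone. Its linear image is closed, so the limit of the images of the quotients is the image of
  some \<open>\<xi>\<close> in the cone. The multipliers \<open>\<nu> + t i *\<^sub>R \<xi>\<close> then define points of the
  domain that approach \<open>(x, xs)\<close> from the same direction, and they move at a linear rate.
\<close>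

section \<open>Transposes of derivatives\<close>

abbreviation adj ::
    "('a::euclidean_space \<Rightarrow>\<^sub>L 'b::euclidean_space) \<Rightarrow> 'b \<Rightarrow> 'a" where
  "adj L \<equiv> adjoint (blinfun_apply L)"

lemma adj_inner: "adj L \<mu> \<bullet> h = \<mu> \<bullet> blinfun_apply L h"
  by (rule adjoint_clauses(2)) (rule bounded_linear.linear[OF blinfun.bounded_linear_right])

lemma norm_adj_le: "norm (adj L \<mu>) \<le> norm L * norm \<mu>"
proof -
  have "adj L \<mu> \<bullet> adj L \<mu> \<le> norm \<mu> * (norm L * norm (adj L \<mu>))"
    unfolding adj_inner
    by (rule order_trans[OF norm_cauchy_schwarz]) (intro mult_left_mono norm_blinfun norm_ge_zero)
  then have "norm (adj L \<mu>) * norm (adj L \<mu>) \<le> (norm L * norm \<mu>) * norm (adj L \<mu>)"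
    by (simp add: power2_norm_eq_inner[symmetric] power2_eq_square algebra_simps)
  then show ?thesis
    by (cases "adj L \<mu> = 0") auto
qed

lemma bounded_bilinear_adj:
  "bounded_bilinear (\<lambda>(L :: 'a::euclidean_space \<Rightarrow>\<^sub>L 'b::euclidean_space). adj L)"
proof -
  have eqI: "a = b" if "\<And>h. a \<bullet> h = b \<bullet> h" for a b :: 'a
  proof -
    have "(a - b) \<bullet> (a - b) = 0" by (simp only: inner_diff_left that diff_self)
    then show ?thesis by simp
  qed
  show ?thesis
  proof
    show "\<exists>K. \<forall>L \<mu>. norm (adj (L :: 'a \<Rightarrow>\<^sub>L 'b) \<mu>) \<le> norm L * norm \<mu> * K"
      by (intro exI[of _ 1]) (simp add: norm_adj_le)
  qed (rule eqI,
      simp add: adj_inner inner_add_left inner_add_right blinfun.add_left blinfun.scaleR_left)+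
qed

interpretation adj: bounded_bilinear "\<lambda>(L :: 'a::euclidean_space \<Rightarrow>\<^sub>L 'b::euclidean_space). adj L"
  by (rule bounded_bilinear_adj)

section \<open>Tangents and normals\<close>

lemma regular_normal_subset_limiting:
  "regular_normal_cone \<Omega> z \<subseteq> limiting_normal_cone \<Omega> z"
  unfolding limiting_normal_cone_def
  by (auto simp: regular_normal_cone_def split: if_splits intro!: exI[of _ "\<lambda>_. z"] exI[of _ "\<lambda>_. _"])

lemma closed_regular_normal_cone: "closed (regular_normal_cone \<Omega> z)"
proof -
  have "negative_polar K = (\<Inter>w\<in>K. {z'. w \<bullet> z' \<le> 0})" for K :: "'a set"
    by (auto simp: negative_polar_def inner_commute)
  then show ?thesis
    by (auto simp: regular_normal_cone_def intro!: closed_halfspace_le closed_INT)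
qed

lemma tangent_coneI:
  assumes "z \<in> \<Omega>" "\<And>k. 0 < t k" "t \<longlonglongrightarrow> (0::real)" "ws \<longlonglongrightarrow> w"
    and "\<And>k::nat. z + t k *\<^sub>R ws k \<in> \<Omega>"
  shows "w \<in> tangent_cone \<Omega> z"
  using assms unfolding tangent_cone_def by blast

text \<open>
  Along a tangent sequence \<open>z + t k *\<^sub>R ws k\<close> the left side of the hypothesis is of order \<open>t k\<close> and the right
  side of order \<open>(t k)\<^sup>2\<close>, so division by \<open>t k\<close> leaves \<open>v \<bullet> w \<le> 0\<close>.
\<close>

lemma proximal_normal_imp_regular:
  fixes v :: "'a::real_inner"
  assumes z: "z \<in> \<Omega>" and r: "0 < r"
    and prox: "\<And>q. q \<in> \<Omega> \<Longrightarrow> norm (q - z) < r \<Longrightarrow> v \<bullet> (q - z) \<le> M * (norm (q - z))\<^sup>2"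
  shows "v \<in> regular_normal_cone \<Omega> z"
proof -
  have "v \<bullet> w \<le> 0" if w: "w \<in> tangent_cone \<Omega> z" for w
  proof -
    obtain t ws where t: "\<And>k. 0 < t k" "t \<longlonglongrightarrow> (0::real)" and ws: "ws \<longlonglongrightarrow> w"
      and mem: "\<And>k::nat. z + t k *\<^sub>R ws k \<in> \<Omega>"
      using w unfolding tangent_cone_def by blast
    have "(\<lambda>k. norm (t k *\<^sub>R ws k)) \<longlonglongrightarrow> norm (0 *\<^sub>R w)"
      by (intro tendsto_intros t ws)
    then have "eventually (\<lambda>k. norm (t k *\<^sub>R ws k) < r) sequentially"
      using order_tendstoD(2) r by fastforce
    then have "eventually (\<lambda>k. v \<bullet> ws k \<le> M * (t k * (norm (ws k))\<^sup>2)) sequentially"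
    proof eventually_elim
      case (elim k)
      have "t k * (v \<bullet> ws k) \<le> t k * (M * (t k * (norm (ws k))\<^sup>2))"
        using prox[OF mem, of k] elim t(1)[of k]
        by (simp add: power_mult_distrib power2_eq_square algebra_simps)
      then show ?case using t(1)[of k] by simp
    qed
    moreover have "(\<lambda>k. M * (t k * (norm (ws k))\<^sup>2)) \<longlonglongrightarrow> M * (0 * (norm w)\<^sup>2)"
      by (intro tendsto_intros t ws)
    moreover have "(\<lambda>k. v \<bullet> ws k) \<longlonglongrightarrow> v \<bullet> w"
      by (intro tendsto_intros ws)
    ultimately have "v \<bullet> w \<le> M * (0 * (norm w)\<^sup>2)"
      by (intro tendsto_le[OF trivial_limit_sequentially])
    then show ?thesis by simp
  qed
  then show ?thesis
    using z by (simp add: regular_normal_cone_def negative_polar_def)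
qed

text \<open>
  The little-o description of regular normals. It relies on finite dimension: unit vectors pointing to
  points of \<open>\<Omega>\<close> that violate the inequality accumulate at a tangent direction, by compactness of the sphere.
\<close>

lemma regular_normal_first_order:
  fixes v :: "'a::euclidean_space"
  assumes v: "v \<in> regular_normal_cone \<Omega> z" and e: "0 < \<epsilon>"
  shows "\<exists>r>0. \<forall>q\<in>\<Omega>. norm (q - z) < r \<longrightarrow> v \<bullet> (q - z) \<le> \<epsilon> * norm (q - z)"
proof (rule ccontr)
  assume not: "\<not> (\<exists>r>0. \<forall>q\<in>\<Omega>. norm (q - z) < r \<longrightarrow> v \<bullet> (q - z) \<le> \<epsilon> * norm (q - z))"
  have "\<exists>q. q \<in> \<Omega> \<and> norm (q - z) < 1 / real (Suc n) \<and> v \<bullet> (q - z) > \<epsilon> * norm (q - z)" for n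
  proof -
    have "0 < 1 / real (Suc n)" by simp
    then show ?thesis using not by (meson not_le)
  qed
  then obtain q where q: "\<And>n. q n \<in> \<Omega>" "\<And>n. norm (q n - z) < 1 / real (Suc n)"
    "\<And>n. v \<bullet> (q n - z) > \<epsilon> * norm (q n - z)"
    by metis
  have pos: "0 < norm (q n - z)" for n
    using q(3)[of n] by (cases "q n = z") auto
  define w where "w n = (1 / norm (q n - z)) *\<^sub>R (q n - z)" for n
  have "\<forall>n. w n \<in> sphere 0 1"
    using pos by (auto simp: w_def)
  then obtain l r where r: "strict_mono r" and l: "(w \<circ> r) \<longlonglongrightarrow> l"
    using compact_sphere[of "0::'a" 1] unfolding compact_def by blast
  have "norm (q n - z) \<le> inverse (real (Suc n))" for n
    using less_imp_le[OF q(2)[of n]] by (simp only: inverse_eq_divide)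
  then have "(\<lambda>n. norm (q n - z)) \<longlonglongrightarrow> 0"
    by (intro tendsto_sandwich[OF _ _ tendsto_const LIMSEQ_inverse_real_of_nat] always_eventually) auto
  then have t: "((\<lambda>n. norm (q n - z)) \<circ> r) \<longlonglongrightarrow> 0"
    using LIMSEQ_subseq_LIMSEQ r by blast
  have reach: "z + norm (q n - z) *\<^sub>R w n = q n" for n
    using pos[of n] by (simp add: w_def)
  have z: "z \<in> \<Omega>" using v by (auto simp: regular_normal_cone_def split: if_splits)
  have "l \<in> tangent_cone \<Omega> z"
    unfolding tangent_cone_def mem_Collect_eq
    using z t l pos q(1) reach
    by (intro conjI exI[of _ "(\<lambda>n. norm (q n - z)) \<circ> r"] exI[of _ "w \<circ> r"]) (simp_all add: comp_def)
  then have "v \<bullet> l \<le> 0"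
    using v z by (auto simp: regular_normal_cone_def negative_polar_def)
  moreover have "\<epsilon> \<le> v \<bullet> w n" for n
    using q(3)[of n] pos[of n] by (simp add: w_def pos_le_divide_eq)
  then have "\<epsilon> \<le> v \<bullet> l"
    by (intro LIMSEQ_le_const[OF tendsto_inner[OF tendsto_const l]]) auto
  ultimately show False using e by simp
qed

lemma converges_from_direction_lim:
  assumes "converges_from_direction ys y v"
  shows "ys \<longlonglongrightarrow> y"
proof -
  obtain t vs where t: "t \<longlonglongrightarrow> (0::real)" and vs: "vs \<longlonglongrightarrow> v"
      and "\<And>k. ys k = y + t k *\<^sub>R vs k"
    using assms unfolding converges_from_direction_def by blast
  then have "ys = (\<lambda>k. y + t k *\<^sub>R vs k)" by auto
  moreover have "(\<lambda>k. y + t k *\<^sub>R vs k) \<longlonglongrightarrow> y + 0 *\<^sub>R v"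
    by (intro tendsto_intros t vs)
  ultimately show ?thesis by simp
qed

text \<open>
  The directional derivative may be computed along varying directions \<open>w k\<close>. In this form it serves for \<open>\<phi>\<close>,
  which maps tangent sequences to tangent sequences, and for its derivative.
\<close>

lemma has_derivative_along_sequence:
  fixes f :: "'a::real_normed_vector \<Rightarrow> 'b::real_normed_vector"
  assumes der: "(f has_derivative f') (at x)"
    and t: "\<And>k. 0 < t k" "t \<longlonglongrightarrow> (0::real)" and w: "w \<longlonglongrightarrow> w0"
  shows "(\<lambda>k. (1 / t k) *\<^sub>R (f (x + t k *\<^sub>R w k) - f x)) \<longlonglongrightarrow> f' w0"
proof -
  interpret f': bounded_linear f' using der by (rule has_derivative_bounded_linear)
  obtain R where R: "0 < R" "\<And>k. norm (w k) \<le> R"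
    using w convergent_imp_Bseq Bseq_def convergent_def by metis
  have tw: "(\<lambda>k. t k *\<^sub>R w k) \<longlonglongrightarrow> 0"
    using tendsto_scaleR[OF t(2) w] by simp
  have "(\<lambda>k. (1 / t k) *\<^sub>R (f (x + t k *\<^sub>R w k) - f x) - f' (w k)) \<longlonglongrightarrow> 0"
  proof (rule tendstoI)
    fix e :: real assume e: "0 < e"
    then have "0 < e / (2 * R)" using R(1) by simp
    then obtain d where d: "0 < d" "\<And>y. norm (y - x) < d \<Longrightarrow>
        norm (f y - f x - f' (y - x)) \<le> e / (2 * R) * norm (y - x)"
      using der[unfolded has_derivative_at_alt] by blast
    have "eventually (\<lambda>k. norm (t k *\<^sub>R w k) < d) sequentially"
      using tendstoD[OF tw d(1)] by (simp add: dist_norm)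
    then show "eventually (\<lambda>k. dist ((1 / t k) *\<^sub>R (f (x + t k *\<^sub>R w k) - f x) - f' (w k)) 0 < e) sequentially"
    proof eventually_elim
      case (elim k)
      have "(1 / t k) *\<^sub>R (f (x + t k *\<^sub>R w k) - f x) - f' (w k)
          = (1 / t k) *\<^sub>R (f (x + t k *\<^sub>R w k) - f x - f' (t k *\<^sub>R w k))"
        using t(1)[of k] by (simp add: f'.scaleR scaleR_diff_right)
      also have "norm \<dots> \<le> (1 / t k) * (e / (2 * R) * norm (t k *\<^sub>R w k))"
        using d(2)[of "x + t k *\<^sub>R w k"] elim t(1)[of k]
        unfolding norm_scaleR by (intro mult_mono) (auto simp: abs_of_pos)
      also have "\<dots> = e / (2 * R) * norm (w k)"
        using t(1)[of k] by simp
      also have "\<dots> \<le> e / (2 * R) * R"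
        using e R by (intro mult_left_mono) auto
      also have "\<dots> < e" using e R by simp
      finally show ?case by simp
    qed
  qed
  from tendsto_add[OF this f'.tendsto[OF w]] show ?thesis by simp
qed

section \<open>Bounded multipliers by exact penalisation\<close>

lemma norm_add_sq:
  fixes a b :: "'a::real_inner"
  shows "(norm (a + b))\<^sup>2 = (norm a)\<^sup>2 + 2 * (a \<bullet> b) + (norm b)\<^sup>2"
  by (simp add: power2_norm_eq_inner inner_add_left inner_add_right inner_commute)

text \<open>
  The graph of the square root lies below its tangents. Applied to \<open>(norm d)\<^sup>2 + \<delta>\<^sup>2\<close>, this bounds the
  smoothed norm from above by a quadratic function that touches it at a given point.
\<close>

lemma sqrt_le_tangent:
  fixes A B :: real
  assumes "0 \<le> A" "0 < B"
  shows "sqrt A \<le> sqrt B + (A - B) / (2 * sqrt B)"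
proof -
  have "0 \<le> (sqrt A - sqrt B)\<^sup>2" by simp
  then have "2 * sqrt A * sqrt B \<le> A + B"
    using assms by (simp add: power2_diff)
  then have "sqrt A * (2 * sqrt B) \<le> 2 * (sqrt B * sqrt B) + (A - B)"
    using assms by simp
  then show ?thesis
    using assms by (simp add: field_simps del: real_sqrt_mult_self)
qed

text \<open>
  The hypothesis says that \<open>(xh, \<phi> xh)\<close> minimises \<open>- v \<bullet> (x - xh) + \<epsilon> * norm (x - xh) + K * norm (\<phi> x - q)\<close> over
  \<open>x\<close> near \<open>xh\<close> and \<open>q \<in> Q\<close>. Two modifications make the first-order conditions usable. A further
  \<open>\<epsilon> * norm (x - xh) + \<epsilon> * (norm (q - \<phi> xh))\<^sup>2\<close> makes the minimiser unique, so that the minimisers of a perturbed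
  problem converge to it. Replacing \<open>norm (\<phi> x - q)\<close> by \<open>sqrt ((norm (\<phi> x - q))\<^sup>2 + \<delta>\<^sup>2)\<close> makes the penalty differentiable.
  Its gradient times \<open>K\<close> has norm at most \<open>K\<close>. Its limits for \<open>\<delta>\<close> tending to zero are normal to \<open>Q\<close> by minimality in
  \<open>q\<close>, and they reproduce \<open>v\<close> up to \<open>2 * \<epsilon>\<close> by minimality in \<open>x\<close>. The nonsmooth term \<open>2 * \<epsilon> * norm (x - xh)\<close>
  causes exactly this error.
\<close>

lemma approximate_multiplier:
  fixes \<phi> :: "'a::euclidean_space \<Rightarrow> 'b::euclidean_space"
  assumes Q: "closed Q" and xh: "\<phi> xh \<in> Q"
    and der: "\<And>x. (\<phi> has_derivative blinfun_apply (\<phi>' x)) (at x)"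
    and cont: "isCont \<phi>' xh"
    and pos: "0 < r" "0 < \<epsilon>" "0 \<le> K"
    and bnd: "\<And>x q. norm (x - xh) < r \<Longrightarrow> q \<in> Q \<Longrightarrow>
        v \<bullet> (x - xh) \<le> \<epsilon> * norm (x - xh) + K * norm (\<phi> x - q)"
  shows "\<exists>\<mu>\<in>limiting_normal_cone Q (\<phi> xh). norm \<mu> \<le> K \<and> norm (v - adj (\<phi>' xh) \<mu>) \<le> 2 * \<epsilon>"
proof -
  define \<delta> where "\<delta> n = inverse (real (Suc n))" for n
  have \<delta>: "\<And>n. 0 < \<delta> n" "\<delta> \<longlonglongrightarrow> 0"
    unfolding \<delta>_def using LIMSEQ_inverse_real_of_nat by auto
  define \<sigma> where "\<sigma> n x q = sqrt ((norm (\<phi> x - q))\<^sup>2 + (\<delta> n)\<^sup>2)" for n x q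
  define G where "G n x q = - (v \<bullet> (x - xh)) + 2 * \<epsilon> * norm (x - xh)
      + \<epsilon> * (norm (q - \<phi> xh))\<^sup>2 + K * \<sigma> n x q" for n x q
  define S where "S = cball xh (r/2) \<times> (Q \<inter> cball (\<phi> xh) 1)"
  have "compact S" unfolding S_def
    by (intro compact_Times closed_Int_compact Q compact_cball)
  have c\<phi>: "continuous_on UNIV \<phi>"
    by (intro continuous_at_imp_continuous_on ballI has_derivative_continuous[OF der])
  have "continuous_on S (\<lambda>p. G n (fst p) (snd p))" for n
    unfolding G_def \<sigma>_def
    by (intro continuous_intros continuous_on_compose2[OF c\<phi>]) auto
  moreover have S0: "(xh, \<phi> xh) \<in> S" using xh pos by (auto simp: S_def)
  ultimately have "\<exists>p\<in>S. \<forall>p'\<in>S. G n (fst p) (snd p) \<le> G n (fst p') (snd p')" for n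
    by (intro continuous_attains_inf[OF \<open>compact S\<close>]) auto
  then obtain P where P: "\<And>n. P n \<in> S"
      "\<And>n p'. p' \<in> S \<Longrightarrow> G n (fst (P n)) (snd (P n)) \<le> G n (fst p') (snd p')"
    by metis
  define X Y where "X n = fst (P n)" and "Y n = snd (P n)" for n
  have XY: "norm (X n - xh) \<le> r/2" "Y n \<in> Q" "norm (Y n - \<phi> xh) \<le> 1" for n
    using P(1)[of n] by (auto simp: S_def X_def Y_def dist_norm norm_minus_commute)
  have min: "G n (X n) (Y n) \<le> G n x q"
    if "norm (x - xh) \<le> r/2" "q \<in> Q" "norm (q - \<phi> xh) \<le> 1" for n x q
    using P(2)[of "(x,q)" n] that by (auto simp: S_def X_def Y_def dist_norm norm_minus_commute)
  have \<sigma>pos: "0 < \<sigma> n x q" and \<sigma>ge: "norm (\<phi> x - q) \<le> \<sigma> n x q" for n x q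
    using \<delta>(1)[of n] by (auto simp: \<sigma>_def intro!: add_nonneg_pos real_le_rsqrt)
  \<comment> \<open>Comparison with \<open>(xh, \<phi> xh)\<close>, where the objective is \<open>K * \<delta> n\<close>.\<close>
  have small: "\<epsilon> * norm (X n - xh) + \<epsilon> * (norm (Y n - \<phi> xh))\<^sup>2 \<le> K * \<delta> n" for n
  proof -
    have "G n (X n) (Y n) \<le> K * \<delta> n"
      using min[of xh "\<phi> xh" n] xh pos \<delta>(1)[of n] by (simp add: G_def \<sigma>_def)
    moreover have "v \<bullet> (X n - xh) \<le> \<epsilon> * norm (X n - xh) + K * norm (\<phi> (X n) - Y n)"
      by (rule bnd) (use XY[of n] pos in auto)
    moreover have "K * norm (\<phi> (X n) - Y n) \<le> K * \<sigma> n (X n) (Y n)"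
      by (intro mult_left_mono \<sigma>ge pos)
    ultimately show ?thesis by (simp add: G_def)
  qed
  have K\<delta>: "(\<lambda>n. K * \<delta> n / \<epsilon>) \<longlonglongrightarrow> 0"
    using tendsto_divide[OF tendsto_mult[OF tendsto_const \<delta>(2), of K] tendsto_const[of \<epsilon>]] pos by simp
  have "norm (X n - xh) \<le> K * \<delta> n / \<epsilon>" "(norm (Y n - \<phi> xh))\<^sup>2 \<le> K * \<delta> n / \<epsilon>" for n
  proof -
    have "0 \<le> \<epsilon> * norm (X n - xh)" "0 \<le> \<epsilon> * (norm (Y n - \<phi> xh))\<^sup>2"
      using pos by auto
    then have "\<epsilon> * norm (X n - xh) \<le> K * \<delta> n" "\<epsilon> * (norm (Y n - \<phi> xh))\<^sup>2 \<le> K * \<delta> n"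
      using small[of n] by linarith+
    then show "norm (X n - xh) \<le> K * \<delta> n / \<epsilon>" "(norm (Y n - \<phi> xh))\<^sup>2 \<le> K * \<delta> n / \<epsilon>"
      using pos by (simp_all add: pos_le_divide_eq mult.commute)
  qed
  then have "(\<lambda>n. norm (X n - xh)) \<longlonglongrightarrow> 0"
    and Y2: "(\<lambda>n. (norm (Y n - \<phi> xh))\<^sup>2) \<longlonglongrightarrow> 0"
    by (intro tendsto_sandwich[OF _ _ tendsto_const K\<delta>] always_eventually allI; simp)+
  then have Xlim: "X \<longlonglongrightarrow> xh"
    by (simp add: LIM_zero_iff tendsto_norm_zero_iff)
  have "(\<lambda>n. norm (Y n - \<phi> xh)) \<longlonglongrightarrow> 0"
    using tendsto_real_sqrt[OF Y2] by simp
  then have Ylim: "Y \<longlonglongrightarrow> \<phi> xh"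
    by (simp add: LIM_zero_iff tendsto_norm_zero_iff)
  define \<mu> where "\<mu> n = (K / \<sigma> n (X n) (Y n)) *\<^sub>R (\<phi> (X n) - Y n)" for n
  have \<mu>K: "norm (\<mu> n) \<le> K" for n
    using \<sigma>pos[of n "X n" "Y n"] mult_left_mono[OF \<sigma>ge pos(3), of "X n" "Y n" n] pos
    by (simp add: \<mu>_def pos_divide_le_eq abs_of_pos)
  \<comment> \<open>A quadratic upper model of the smoothed penalty, with slope \<open>\<mu> n\<close>.\<close>
  have incr: "K * \<sigma> n x q \<le> K * \<sigma> n (X n) (Y n) + \<mu> n \<bullet> d
      + K / (2 * \<sigma> n (X n) (Y n)) * (norm d)\<^sup>2"
    if d: "\<phi> x - q = \<phi> (X n) - Y n + d" for n x q d
  proof -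
    let ?s = "\<sigma> n (X n) (Y n)"
    have "\<sigma> n x q \<le> ?s + ((norm (\<phi> x - q))\<^sup>2 - (norm (\<phi> (X n) - Y n))\<^sup>2) / (2 * ?s)"
      using sqrt_le_tangent[of "(norm (\<phi> x - q))\<^sup>2 + (\<delta> n)\<^sup>2" "(norm (\<phi> (X n) - Y n))\<^sup>2 + (\<delta> n)\<^sup>2"]
        \<delta>(1)[of n] by (simp add: \<sigma>_def add_nonneg_pos)
    also have "(norm (\<phi> x - q))\<^sup>2 - (norm (\<phi> (X n) - Y n))\<^sup>2
        = 2 * ((\<phi> (X n) - Y n) \<bullet> d) + (norm d)\<^sup>2"
      unfolding d norm_add_sq by simp
    finally have "K * \<sigma> n x q \<le> K * (?s + (2 * ((\<phi> (X n) - Y n) \<bullet> d) + (norm d)\<^sup>2) / (2 * ?s))"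
      by (intro mult_left_mono pos)
    moreover have "\<mu> n \<bullet> d = K * ((\<phi> (X n) - Y n) \<bullet> d) / ?s"
      by (simp add: \<mu>_def)
    moreover have "K * (?s + (2 * ((\<phi> (X n) - Y n) \<bullet> d) + (norm d)\<^sup>2) / (2 * ?s))
        = K * ?s + K * ((\<phi> (X n) - Y n) \<bullet> d) / ?s + K / (2 * ?s) * (norm d)\<^sup>2"
      using \<sigma>pos[of n "X n" "Y n"] by (simp add: field_simps)
    ultimately show ?thesis by simp
  qed
  \<comment> \<open>Minimality in \<open>q\<close>: the vector is a proximal normal, the quadratic constant coming from \<open>incr\<close>.\<close>
  have normal: "\<mu> n - (2 * \<epsilon>) *\<^sub>R (Y n - \<phi> xh) \<in> regular_normal_cone Q (Y n)"
    if n: "norm (Y n - \<phi> xh) < 1" for n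
  proof (rule proximal_normal_imp_regular[OF XY(2)])
    show "0 < 1 - norm (Y n - \<phi> xh)" using n by simp
    fix q assume q: "q \<in> Q" "norm (q - Y n) < 1 - norm (Y n - \<phi> xh)"
    have "norm (q - \<phi> xh) \<le> 1"
      using q norm_triangle_ineq[of "q - Y n" "Y n - \<phi> xh"] by simp
    then have "G n (X n) (Y n) \<le> G n (X n) q"
      using min XY q by blast
    moreover have "\<epsilon> * (norm (q - \<phi> xh))\<^sup>2 = \<epsilon> * (norm (Y n - \<phi> xh))\<^sup>2
        + 2 * (\<epsilon> * ((Y n - \<phi> xh) \<bullet> (q - Y n))) + \<epsilon> * (norm (q - Y n))\<^sup>2"
    proof -
      have "q - \<phi> xh = (Y n - \<phi> xh) + (q - Y n)" by simp
      then have "(norm (q - \<phi> xh))\<^sup>2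
          = (norm (Y n - \<phi> xh))\<^sup>2 + 2 * ((Y n - \<phi> xh) \<bullet> (q - Y n)) + (norm (q - Y n))\<^sup>2"
        by (simp only: norm_add_sq)
      then show ?thesis by (simp add: distrib_left)
    qed
    moreover have "K * \<sigma> n (X n) q \<le> K * \<sigma> n (X n) (Y n) - \<mu> n \<bullet> (q - Y n)
      + K / (2 * \<sigma> n (X n) (Y n)) * (norm (q - Y n))\<^sup>2"
      using incr[of "X n" q n "- (q - Y n)"] by (simp add: norm_minus_commute inner_diff_right)
    moreover have "(\<mu> n - (2 * \<epsilon>) *\<^sub>R (Y n - \<phi> xh)) \<bullet> (q - Y n)
        = \<mu> n \<bullet> (q - Y n) - 2 * (\<epsilon> * ((Y n - \<phi> xh) \<bullet> (q - Y n)))"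
      by (simp only: inner_diff_left[of "\<mu> n"] inner_scaleR_left mult.assoc)
    ultimately show "(\<mu> n - (2 * \<epsilon>) *\<^sub>R (Y n - \<phi> xh)) \<bullet> (q - Y n)
        \<le> (\<epsilon> + K / (2 * \<sigma> n (X n) (Y n))) * (norm (q - Y n))\<^sup>2"
      unfolding G_def distrib_right by linarith
  qed
  \<comment> \<open>Minimality in \<open>x\<close>: dividing by the step length along \<open>h\<close> and passing to the limit gives
    \<open>h \<bullet> h \<le> 2 * \<epsilon> * norm h\<close> if \<open>h\<close> is the residual itself.\<close>
  have stat: "norm (v - adj (\<phi>' (X n)) (\<mu> n)) \<le> 2 * \<epsilon>" if n: "norm (X n - xh) < r/2" for n
  proof -
    define C where "C = K / (2 * \<sigma> n (X n) (Y n))"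
    define h where "h = v - adj (\<phi>' (X n)) (\<mu> n)"
    define s where "s j = (inverse (real (Suc j)))" for j
    have s: "\<And>j. 0 < s j" "s \<longlonglongrightarrow> 0"
      unfolding s_def using LIMSEQ_inverse_real_of_nat by auto
    define D where "D j = (1 / s j) *\<^sub>R (\<phi> (X n + s j *\<^sub>R h) - \<phi> (X n))" for j
    have Dlim: "D \<longlonglongrightarrow> \<phi>' (X n) h"
      unfolding D_def by (rule has_derivative_along_sequence[OF der s tendsto_const])
    have "(\<lambda>j. norm (X n + s j *\<^sub>R h - xh)) \<longlonglongrightarrow> norm (X n + 0 *\<^sub>R h - xh)"
      by (intro tendsto_intros s)
    then have "eventually (\<lambda>j. norm (X n + s j *\<^sub>R h - xh) < r/2) sequentially"
      using order_tendstoD(2) n by fastforce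
    then have "eventually (\<lambda>j. v \<bullet> h \<le> 2 * \<epsilon> * norm h + \<mu> n \<bullet> D j
        + C * (s j * (norm (D j))\<^sup>2)) sequentially"
    proof (rule eventually_mono)
      fix j assume elim: "norm (X n + s j *\<^sub>R h - xh) < r/2"
      let ?x = "X n + s j *\<^sub>R h"
      have "G n (X n) (Y n) \<le> G n ?x (Y n)"
        by (intro min XY less_imp_le[OF elim])
      moreover have "K * \<sigma> n ?x (Y n) \<le> K * \<sigma> n (X n) (Y n) + \<mu> n \<bullet> (s j *\<^sub>R D j)
          + C * (norm (s j *\<^sub>R D j))\<^sup>2"
        unfolding C_def using s(1)[of j] by (intro incr) (simp add: D_def)
      moreover have "\<epsilon> * norm (?x - xh) \<le> \<epsilon> * (norm (X n - xh) + s j * norm h)"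
      proof (rule mult_left_mono)
        show "norm (?x - xh) \<le> norm (X n - xh) + s j * norm h"
        proof -
          have "norm (?x - xh) = norm ((X n - xh) + s j *\<^sub>R h)" by (simp only: diff_add_eq)
          also have "\<dots> \<le> norm (X n - xh) + norm (s j *\<^sub>R h)" by (rule norm_triangle_ineq)
          also have "norm (s j *\<^sub>R h) = s j * norm h" using s(1)[of j] by simp
          finally show ?thesis .
        qed
      qed (use pos in simp)
      moreover have "v \<bullet> (?x - xh) = v \<bullet> (X n - xh) + s j * (v \<bullet> h)"
        by (simp add: inner_diff_right inner_add_right)
      moreover have "C * (norm (s j *\<^sub>R D j))\<^sup>2 = C * (s j * (s j * (norm (D j))\<^sup>2))"
        by (simp only: norm_scaleR power_mult_distrib power2_abs) (simp only: power2_eq_square mult.assoc)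
      ultimately have "s j * (v \<bullet> h) \<le> 2 * (\<epsilon> * (s j * norm h)) + s j * (\<mu> n \<bullet> D j)
          + C * (s j * (s j * (norm (D j))\<^sup>2))"
        unfolding G_def inner_scaleR_right distrib_left mult.assoc by linarith
      also have "\<dots> = s j * (2 * \<epsilon> * norm h + \<mu> n \<bullet> D j + C * (s j * (norm (D j))\<^sup>2))"
        by (simp only: distrib_left mult.left_commute mult.commute mult.assoc)
      finally show "v \<bullet> h \<le> 2 * \<epsilon> * norm h + \<mu> n \<bullet> D j
        + C * (s j * (norm (D j))\<^sup>2)"
        using s(1)[of j] by simp
    qed
    moreover have "(\<lambda>j. 2 * \<epsilon> * norm h + \<mu> n \<bullet> D j + C * (s j * (norm (D j))\<^sup>2))
      \<longlonglongrightarrow> 2 * \<epsilon> * norm h + \<mu> n \<bullet> \<phi>' (X n) h + C * (0 * (norm (\<phi>' (X n) h))\<^sup>2)"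
      by (intro tendsto_intros s Dlim)
    ultimately have "v \<bullet> h \<le> 2 * \<epsilon> * norm h + \<mu> n \<bullet> \<phi>' (X n) h
        + C * (0 * (norm (\<phi>' (X n) h))\<^sup>2)"
      by (intro tendsto_le[OF trivial_limit_sequentially _ tendsto_const])
    then have "v \<bullet> h \<le> 2 * \<epsilon> * norm h + \<mu> n \<bullet> \<phi>' (X n) h" by simp
    then have "h \<bullet> h \<le> 2 * \<epsilon> * norm h"
      unfolding h_def by (simp add: inner_diff_left adj_inner)
    then have "norm h * norm h \<le> (2 * \<epsilon>) * norm h"
      by (simp add: power2_norm_eq_inner[symmetric] power2_eq_square)
    then show ?thesis
      using pos unfolding h_def[symmetric] by (cases "h = 0") auto
  qed
  have "\<forall>n. \<mu> n \<in> cball 0 K" using \<mu>K by simp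
  then obtain \<nu> \<rho> where \<rho>: "strict_mono \<rho>" and \<nu>lim: "(\<mu> \<circ> \<rho>) \<longlonglongrightarrow> \<nu>"
    using compact_cball[of "0::'b" K] unfolding compact_def by blast
  have X\<rho>: "(\<lambda>n. X (\<rho> n)) \<longlonglongrightarrow> xh" and Y\<rho>: "(\<lambda>n. Y (\<rho> n)) \<longlonglongrightarrow> \<phi> xh"
    using LIMSEQ_subseq_LIMSEQ[OF _ \<rho>] Xlim Ylim by (auto simp: comp_def)
  have \<nu>lim': "(\<lambda>n. \<mu> (\<rho> n)) \<longlonglongrightarrow> \<nu>" using \<nu>lim by (simp add: comp_def)
  have near: "eventually (\<lambda>n. norm (X (\<rho> n) - xh) < r/2) sequentially"
      "eventually (\<lambda>n. norm (Y (\<rho> n) - \<phi> xh) < 1) sequentially"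
    using tendstoD[OF X\<rho>, of "r/2"] tendstoD[OF Y\<rho>, of 1] pos by (auto simp: dist_norm)
  have shifted: "(\<lambda>n. \<mu> (\<rho> n) - (2 * \<epsilon>) *\<^sub>R (Y (\<rho> n) - \<phi> xh)) \<longlonglongrightarrow> \<nu> - (2 * \<epsilon>) *\<^sub>R (\<phi> xh - \<phi> xh)"
    by (intro tendsto_intros \<nu>lim' Y\<rho>)
  obtain N where N: "\<And>n. n \<ge> N \<Longrightarrow> norm (Y (\<rho> n) - \<phi> xh) < 1"
    using near(2) unfolding eventually_sequentially by blast
  have "(\<lambda>n. Y (\<rho> (n + N))) \<longlonglongrightarrow> \<phi> xh"
    by (rule LIMSEQ_ignore_initial_segment[OF Y\<rho>])
  moreover have "(\<lambda>n. \<mu> (\<rho> (n + N)) - (2 * \<epsilon>) *\<^sub>R (Y (\<rho> (n + N)) - \<phi> xh)) \<longlonglongrightarrow> \<nu>"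
    using LIMSEQ_ignore_initial_segment[OF shifted, of N] by simp
  moreover have "\<mu> (\<rho> (k + N)) - (2 * \<epsilon>) *\<^sub>R (Y (\<rho> (k + N)) - \<phi> xh)
      \<in> regular_normal_cone Q (Y (\<rho> (k + N)))" for k
    by (rule normal) (simp add: N)
  ultimately have "\<nu> \<in> limiting_normal_cone Q (\<phi> xh)"
    unfolding limiting_normal_cone_def using xh by blast
  moreover have "norm \<nu> \<le> K"
    by (rule LIMSEQ_le_const2[OF tendsto_norm[OF \<nu>lim']]) (simp add: \<mu>K)
  moreover have "(\<lambda>n. norm (v - adj (\<phi>' (X (\<rho> n))) (\<mu> (\<rho> n)))) \<longlonglongrightarrow> norm (v - adj (\<phi>' xh) \<nu>)"
    by (intro tendsto_intros adj.tendsto \<nu>lim' isCont_tendsto_compose[OF cont X\<rho>])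
  then have "norm (v - adj (\<phi>' xh) \<nu>) \<le> 2 * \<epsilon>"
    by (rule tendsto_upperbound) (use eventually_mono[OF near(1) stat] in auto)
  ultimately show ?thesis by blast
qed

text \<open>
  Exact penalisation. The point \<open>p\<close> of the preimage closest to \<open>x\<close> satisfies \<open>norm (p - xh) \<le> 2 * norm (x - xh)\<close>,
  so the little-o inequality applies to it. Passing from \<open>p\<close> to \<open>x\<close> costs at most \<open>(\<epsilon> + norm v) * norm (x - p)\<close>,
  and subregularity bounds \<open>norm (x - p)\<close> by \<open>\<kappa> * norm (\<phi> x - q)\<close> for every \<open>q \<in> Q\<close>. Clarke regularity enters in the final
  limit, where it makes the limiting normal cone closed.
\<close>

lemma bounded_multiplier:
  fixes \<phi> :: "'a::euclidean_space \<Rightarrow> 'b::euclidean_space"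
  assumes Q: "closed Q" and clarke: "clarke_regular_at Q (\<phi> xh)"
    and der: "\<And>x. (\<phi> has_derivative blinfun_apply (\<phi>' x)) (at x)"
    and cont: "isCont \<phi>' xh"
    and v: "v \<in> regular_normal_cone (\<phi> -` Q) xh"
    and \<kappa>: "0 < \<kappa>" and U: "open U" "xh \<in> U"
    and sub: "\<And>x. x \<in> U \<Longrightarrow> infdist x (\<phi> -` Q) \<le> \<kappa> * infdist (\<phi> x) Q"
  shows "\<exists>\<mu>\<in>limiting_normal_cone Q (\<phi> xh). adj (\<phi>' xh) \<mu> = v \<and> norm \<mu> \<le> \<kappa> * norm v"
proof -
  have xh: "\<phi> xh \<in> Q"
    using v by (auto simp: regular_normal_cone_def split: if_splits)
  have c\<phi>: "continuous_on UNIV \<phi>"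
    by (intro continuous_at_imp_continuous_on ballI has_derivative_continuous[OF der])
  have C: "closed (\<phi> -` Q)" using closed_vimage[OF Q c\<phi>] by simp
  have approx: "\<exists>\<mu>\<in>limiting_normal_cone Q (\<phi> xh). norm \<mu> \<le> \<kappa> * (\<epsilon> + norm v)
      \<and> norm (v - adj (\<phi>' xh) \<mu>) \<le> 2 * \<epsilon>" if e: "0 < \<epsilon>" for \<epsilon>
  proof -
    obtain r where r: "0 < r" "\<And>q. q \<in> \<phi> -` Q \<Longrightarrow> norm (q - xh) < r \<Longrightarrow> v \<bullet> (q - xh) \<le> \<epsilon> * norm (q - xh)"
      using regular_normal_first_order[OF v e] by blast
    obtain r' where r': "0 < r'" "ball xh r' \<subseteq> U" by (rule openE[OF U])
    show ?thesis
    proof (rule approximate_multiplier[OF Q xh der cont])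
      show "0 < min (r/2) r'" "0 < \<epsilon>" "0 \<le> \<kappa> * (\<epsilon> + norm v)"
        using r r' e \<kappa> by auto
      fix x q assume x: "norm (x - xh) < min (r/2) r'" and q: "q \<in> Q"
      obtain p where p: "p \<in> \<phi> -` Q" "infdist x (\<phi> -` Q) = dist x p"
        using infdist_attains_inf[OF C] xh by (metis empty_iff vimage_eq)
      have "dist x p \<le> dist x xh" using infdist_le[of xh "\<phi> -` Q" x] xh p by simp
      then have "norm (x - p) \<le> norm (x - xh)" by (simp add: dist_norm)
      moreover have pt: "norm (p - xh) \<le> norm (x - xh) + norm (x - p)"
        using norm_triangle_ineq4[of "x - xh" "x - p"] by simp
      ultimately have "v \<bullet> (p - xh) \<le> \<epsilon> * norm (p - xh)"
        using x by (intro r p) auto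
      also have "\<dots> \<le> \<epsilon> * (norm (x - xh) + norm (x - p))"
        using pt e by simp
      finally have 1: "v \<bullet> (p - xh) \<le> \<epsilon> * (norm (x - xh) + norm (x - p))" .
      have "x \<in> U" using x r' by (auto simp: dist_norm norm_minus_commute subset_eq)
      then have "norm (x - p) \<le> \<kappa> * infdist (\<phi> x) Q" using sub[of x] p(2) by (simp add: dist_norm)
      also have "\<dots> \<le> \<kappa> * norm (\<phi> x - q)"
        using infdist_le[OF q, of "\<phi> x"] \<kappa> by (simp add: dist_norm)
      finally have "(\<epsilon> + norm v) * norm (x - p) \<le> (\<epsilon> + norm v) * (\<kappa> * norm (\<phi> x - q))"
        using e by (intro mult_left_mono) auto
      moreover have "v \<bullet> (x - xh) = v \<bullet> (p - xh) + v \<bullet> (x - p)"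
        by (simp add: inner_diff_right)
      moreover have "v \<bullet> (x - p) \<le> norm v * norm (x - p)" by (rule norm_cauchy_schwarz)
      ultimately show "v \<bullet> (x - xh) \<le> \<epsilon> * norm (x - xh) + \<kappa> * (\<epsilon> + norm v) * norm (\<phi> x - q)"
        using 1 by (simp add: algebra_simps)
    qed
  qed
  define \<epsilon> where "\<epsilon> n = inverse (real (Suc n))" for n
  have \<epsilon>: "\<And>n. 0 < \<epsilon> n" "\<epsilon> \<longlonglongrightarrow> 0" "\<And>n. \<epsilon> n \<le> 1"
    unfolding \<epsilon>_def using LIMSEQ_inverse_real_of_nat by (auto simp: field_simps)
  obtain \<mu> where \<mu>: "\<And>n. \<mu> n \<in> limiting_normal_cone Q (\<phi> xh)"
      "\<And>n. norm (\<mu> n) \<le> \<kappa> * (\<epsilon> n + norm v)"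
      "\<And>n. norm (v - adj (\<phi>' xh) (\<mu> n)) \<le> 2 * \<epsilon> n"
    using approx[OF \<epsilon>(1)] by metis
  have "norm (\<mu> n) \<le> \<kappa> * (1 + norm v)" for n
    by (rule order_trans[OF \<mu>(2)]) (use \<kappa> \<epsilon>(3)[of n] in auto)
  then have "\<forall>n. \<mu> n \<in> cball 0 (\<kappa> * (1 + norm v))" by simp
  then obtain \<nu> \<rho> where \<rho>: "strict_mono \<rho>" and \<nu>lim: "(\<mu> \<circ> \<rho>) \<longlonglongrightarrow> \<nu>"
    using compact_cball[of "0::'b"] unfolding compact_def by blast
  have \<epsilon>\<rho>: "(\<epsilon> \<circ> \<rho>) \<longlonglongrightarrow> 0" using LIMSEQ_subseq_LIMSEQ[OF \<epsilon>(2) \<rho>] .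
  have "closed (limiting_normal_cone Q (\<phi> xh))"
    using closed_regular_normal_cone[of Q "\<phi> xh"] clarke by (simp add: clarke_regular_at_def)
  then have "\<nu> \<in> limiting_normal_cone Q (\<phi> xh)"
    by (rule closed_sequentially[OF _ _ \<nu>lim]) (simp add: \<mu>(1))
  moreover have "norm (v - adj (\<phi>' xh) \<nu>) \<le> 2 * 0"
  proof (rule LIMSEQ_le)
    show "(\<lambda>n. norm (v - adj (\<phi>' xh) ((\<mu> \<circ> \<rho>) n))) \<longlonglongrightarrow> norm (v - adj (\<phi>' xh) \<nu>)"
      by (intro tendsto_intros adj.tendsto \<nu>lim)
    show "(\<lambda>n. 2 * (\<epsilon> \<circ> \<rho>) n) \<longlonglongrightarrow> 2 * 0"
      by (intro tendsto_intros \<epsilon>\<rho>)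
  qed (simp add: \<mu>(3))
  moreover have "norm \<nu> \<le> \<kappa> * (0 + norm v)"
  proof (rule LIMSEQ_le)
    show "(\<lambda>n. norm ((\<mu> \<circ> \<rho>) n)) \<longlonglongrightarrow> norm \<nu>"
      by (intro tendsto_intros \<nu>lim)
    show "(\<lambda>n. \<kappa> * ((\<epsilon> \<circ> \<rho>) n + norm v)) \<longlonglongrightarrow> \<kappa> * (0 + norm v)"
      by (intro tendsto_intros \<epsilon>\<rho>)
  qed (simp add: \<mu>(2))
  ultimately show ?thesis by auto
qed

text \<open>
  The derivative maps tangents of the preimage to tangents of \<open>Q\<close>, and polarity reverses the
  inclusion.
\<close>

lemma regular_normal_preimage:
  fixes \<phi> :: "'a::euclidean_space \<Rightarrow> 'b::euclidean_space"
  assumes der: "(\<phi> has_derivative blinfun_apply L) (at z)"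
    and \<mu>: "\<mu> \<in> regular_normal_cone Q (\<phi> z)"
  shows "adj L \<mu> \<in> regular_normal_cone (\<phi> -` Q) z"
proof -
  have z: "\<phi> z \<in> Q" using \<mu> by (auto simp: regular_normal_cone_def split: if_splits)
  have "L w \<in> tangent_cone Q (\<phi> z)" if w: "w \<in> tangent_cone (\<phi> -` Q) z" for w
  proof -
    obtain t ws where t: "\<And>k. 0 < t k" "t \<longlonglongrightarrow> (0::real)" and ws: "ws \<longlonglongrightarrow> w"
      and mem: "\<And>k::nat. \<phi> (z + t k *\<^sub>R ws k) \<in> Q"
      using w unfolding tangent_cone_def by blast
    have "\<phi> z + t k *\<^sub>R ((1 / t k) *\<^sub>R (\<phi> (z + t k *\<^sub>R ws k) - \<phi> z)) \<in> Q" for k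
      using mem[of k] t(1)[of k] by simp
    moreover note has_derivative_along_sequence[OF der t ws]
    ultimately show ?thesis
      unfolding tangent_cone_def mem_Collect_eq using z t by blast
  qed
  then show ?thesis
    using \<mu> z by (auto simp: regular_normal_cone_def negative_polar_def adj_inner)
qed

section \<open>Normal cones of convex sets\<close>

lemma regular_normal_cone_convex:
  fixes \<Omega> :: "'a::real_inner set"
  assumes \<Omega>: "convex \<Omega>" and z: "z \<in> \<Omega>"
  shows "regular_normal_cone \<Omega> z = {v. \<forall>q\<in>\<Omega>. v \<bullet> (q - z) \<le> 0}"
proof (intro Set.equalityI subsetI CollectI ballI)
  fix v q assume v: "v \<in> regular_normal_cone \<Omega> z" and q: "q \<in> \<Omega>"
  have "z + (1 / real (Suc k)) *\<^sub>R (q - z) \<in> \<Omega>" for k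
  proof -
    have "z + (1 / real (Suc k)) *\<^sub>R (q - z) = (1 - 1 / real (Suc k)) *\<^sub>R z + (1 / real (Suc k)) *\<^sub>R q"
      by (simp add: algebra_simps)
    also have "\<dots> \<in> \<Omega>"
      by (rule convexD[OF \<Omega> z q]) (auto simp: field_simps)
    finally show ?thesis .
  qed
  moreover have "(\<lambda>k. 1 / real (Suc k)) \<longlonglongrightarrow> 0"
    using LIMSEQ_Suc lim_1_over_n by blast
  ultimately have "q - z \<in> tangent_cone \<Omega> z"
    unfolding tangent_cone_def using z
    by (auto intro!: exI[of _ "\<lambda>k. 1 / real (Suc k)"] exI[of _ "\<lambda>_. q - z"])
  then show "v \<bullet> (q - z) \<le> 0"
    using v z by (auto simp: regular_normal_cone_def negative_polar_def)
next
  fix v assume "v \<in> {v. \<forall>q\<in>\<Omega>. v \<bullet> (q - z) \<le> 0}"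
  then show "v \<in> regular_normal_cone \<Omega> z"
    using proximal_normal_imp_regular[OF z, of 1 v 0] by simp
qed

text \<open>
  For convex sets regular normality is the global inequality \<open>v \<bullet> (q - z) \<le> 0\<close>, which is stable under limits
  in \<open>v\<close> and \<open>z\<close>.
\<close>

lemma convex_imp_clarke_regular:
  fixes \<Omega> :: "'a::real_inner set"
  assumes \<Omega>: "convex \<Omega>"
  shows "clarke_regular_at \<Omega> z"
  unfolding clarke_regular_at_def
proof (rule Set.equalityI[OF regular_normal_subset_limiting], rule subsetI)
  fix v assume "v \<in> limiting_normal_cone \<Omega> z"
  then obtain zs vs where z: "z \<in> \<Omega>" and lim: "zs \<longlonglongrightarrow> z" "vs \<longlonglongrightarrow> v"
    and vs: "\<And>k::nat. vs k \<in> regular_normal_cone \<Omega> (zs k)"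
    unfolding limiting_normal_cone_def by blast
  have zs: "zs k \<in> \<Omega>" for k using vs[of k] by (auto simp: regular_normal_cone_def split: if_splits)
  have "v \<bullet> (q - z) \<le> 0" if q: "q \<in> \<Omega>" for q
  proof (rule LIMSEQ_le_const2)
    show "(\<lambda>k. vs k \<bullet> (q - zs k)) \<longlonglongrightarrow> v \<bullet> (q - z)" by (intro tendsto_intros lim)
    show "\<exists>N. \<forall>n\<ge>N. vs n \<bullet> (q - zs n) \<le> 0"
      using vs zs q regular_normal_cone_convex[OF \<Omega> zs] by blast
  qed
  then show "v \<in> regular_normal_cone \<Omega> z"
    using regular_normal_cone_convex[OF \<Omega> z] by blast
qed

lemma convex_imp_clarke_regular_near:
  fixes \<Omega> :: "'a::real_inner set"
  shows "convex \<Omega> \<Longrightarrow> clarke_regular_near \<Omega> z"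
  by (simp add: clarke_regular_near_def convex_imp_clarke_regular)

section \<open>Normal cones of polyhedral sets\<close>

definition halfspaces :: "('a::real_inner \<times> real) set \<Rightarrow> 'a set" where
  "halfspaces G = {q. \<forall>(a, b)\<in>G. a \<bullet> q \<le> b}"

text \<open>
  Only the constraint vectors are collected, because they determine the tangent and normal cones at \<open>q\<close>.
\<close>

definition active :: "('a::real_inner \<times> real) set \<Rightarrow> 'a \<Rightarrow> 'a set" where
  "active G q = {a. \<exists>b. (a, b) \<in> G \<and> a \<bullet> q = b}"

lemma polyhedron_halfspaces:
  assumes "polyhedron Q"
  obtains G where "finite G" "Q = halfspaces G"
proof -
  obtain F where F: "finite F" "Q = \<Inter> F"
      and "\<forall>h\<in>F. \<exists>a b. a \<noteq> 0 \<and> h = {x. a \<bullet> x \<le> b}"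
    using assms unfolding polyhedron_def by (elim exE conjE)
  then obtain a b where ab: "\<And>h. h \<in> F \<Longrightarrow> h = {x. a h \<bullet> x \<le> b h}" by metis
  show thesis
  proof
    show "finite ((\<lambda>h. (a h, b h)) ` F)" using F by simp
    show "Q = halfspaces ((\<lambda>h. (a h, b h)) ` F)"
      unfolding F(2) halfspaces_def using ab by auto
  qed
qed

lemma finite_active: "finite G \<Longrightarrow> finite (active G q)"
  by (rule finite_subset[of _ "fst ` G"]) (force simp: active_def)+

lemma active_halfspaces_cone: "active ((\<lambda>a. (a, 0)) ` A) w = {a \<in> A. a \<bullet> w = 0}"
  by (auto simp: active_def)

text \<open>
  Inactive constraints have slack at \<open>q\<close>, so short steps do not violate them. The tangent cone is again given by
  finitely many half-spaces, which makes the lemma applicable to the tangent cone itself.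
\<close>

lemma tangent_cone_halfspaces:
  assumes G: "finite G" and q: "q \<in> halfspaces G"
  shows "tangent_cone (halfspaces G) q = halfspaces ((\<lambda>a. (a, 0)) ` active G q)"
proof (intro Set.equalityI subsetI)
  fix v assume "v \<in> tangent_cone (halfspaces G) q"
  then obtain t ws where t: "\<And>k. 0 < t k" and ws: "ws \<longlonglongrightarrow> v"
      and mem: "\<And>k::nat. q + t k *\<^sub>R ws k \<in> halfspaces G"
    unfolding tangent_cone_def by blast
  have "a \<bullet> v \<le> 0" if a: "a \<in> active G q" for a
  proof (rule LIMSEQ_le_const2[OF tendsto_inner[OF tendsto_const ws]])
    have "a \<bullet> ws k \<le> 0" for k
      using mem[of k] a t[of k]
      by (auto simp: active_def halfspaces_def inner_add_right mult_le_0_iff dest!: bspec)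
    then show "\<exists>N. \<forall>n\<ge>N. a \<bullet> ws n \<le> 0" by blast
  qed
  then show "v \<in> halfspaces ((\<lambda>a. (a, 0)) ` active G q)" by (auto simp: halfspaces_def)
next
  fix v assume v: "v \<in> halfspaces ((\<lambda>a. (a, 0)) ` active G q)"
  define s where "s k = (inverse (real (Suc k)))" for k
  have s: "\<And>k. 0 < s k" "s \<longlonglongrightarrow> 0"
    unfolding s_def using LIMSEQ_inverse_real_of_nat by auto
  have "eventually (\<lambda>k. a \<bullet> (q + s k *\<^sub>R v) \<le> b) sequentially" if ab: "(a, b) \<in> G" for a b
  proof (cases "a \<bullet> q = b")
    case True
    then have "a \<bullet> v \<le> 0" using v ab by (auto simp: halfspaces_def active_def)
    then show ?thesis
      using True s(1) by (auto simp: inner_add_right mult_le_0_iff less_imp_le intro!: always_eventually)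
  next
    case False
    then have "a \<bullet> q < b" using q ab by (auto simp: halfspaces_def)
    moreover have "(\<lambda>k. a \<bullet> (q + s k *\<^sub>R v)) \<longlonglongrightarrow> a \<bullet> (q + 0 *\<^sub>R v)"
      by (intro tendsto_intros s)
    ultimately have "eventually (\<lambda>k. a \<bullet> (q + s k *\<^sub>R v) < b) sequentially"
      using order_tendstoD(2) by fastforce
    then show ?thesis by (rule eventually_mono) simp
  qed
  then have "eventually (\<lambda>k. \<forall>p\<in>G. fst p \<bullet> (q + s k *\<^sub>R v) \<le> snd p) sequentially"
    by (intro eventually_ball_finite[OF G]) auto
  then obtain N where "\<And>k. k \<ge> N \<Longrightarrow> q + s k *\<^sub>R v \<in> halfspaces G"
    unfolding eventually_sequentially halfspaces_def by force
  then show "v \<in> tangent_cone (halfspaces G) q"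
    unfolding tangent_cone_def using q s LIMSEQ_ignore_initial_segment[OF s(2), of N]
    by (auto intro!: exI[of _ "\<lambda>k. s (k + N)"] exI[of _ "\<lambda>_. v"])
qed

text \<open>
  Farkas' lemma. A finitely generated cone is closed, so a point outside can be separated from it, and
  the negative of the separating vector lies in the polyhedral cone.
\<close>

lemma negative_polar_halfspaces:
  fixes A :: "'a::euclidean_space set"
  assumes A: "finite A"
  shows "negative_polar (halfspaces ((\<lambda>a. (a, 0)) ` A)) = convex_cone hull A"
proof (intro Set.equalityI subsetI)
  fix z assume z: "z \<in> negative_polar (halfspaces ((\<lambda>a. (a, 0)) ` A))"
  show "z \<in> convex_cone hull A"
  proof (rule ccontr)
    assume "z \<notin> convex_cone hull A"
    then obtain c b where cb: "c \<bullet> z < b" "\<And>y. y \<in> convex_cone hull A \<Longrightarrow> b < c \<bullet> y"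
      using separating_hyperplane_closed_point[OF convex_convex_cone_hull closed_convex_cone_hull[OF A]]
      by blast
    have b: "b < 0" using cb(2)[OF convex_cone_hull_contains_0] by simp
    have "0 \<le> c \<bullet> y" if y: "y \<in> A" for y
    proof (rule ccontr)
      assume neg: "\<not> 0 \<le> c \<bullet> y"
      then have "(b / (c \<bullet> y)) *\<^sub>R y \<in> convex_cone hull A"
        using b y by (intro convex_cone_hull_mul) (auto simp: hull_inc zero_le_divide_iff)
      then show False using cb(2) neg by fastforce
    qed
    then have "- c \<in> halfspaces ((\<lambda>a. (a, 0)) ` A)"
      by (auto simp: halfspaces_def inner_commute)
    then show False using z cb(1) b by (force simp: negative_polar_def inner_commute)
  qed
next
  fix z assume z: "z \<in> convex_cone hull A"
  have "convex_cone (negative_polar K)" for K :: "'a set"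
    unfolding convex_cone_iff negative_polar_def
    by (auto simp: inner_add_left add_nonpos_nonpos mult_nonneg_nonpos)
  moreover have "A \<subseteq> negative_polar (halfspaces ((\<lambda>a. (a, 0)) ` A))"
    by (auto simp: negative_polar_def halfspaces_def)
  ultimately have "convex_cone hull A \<subseteq> negative_polar (halfspaces ((\<lambda>a. (a, 0)) ` A))"
    by (intro hull_minimal)
  then show "z \<in> negative_polar (halfspaces ((\<lambda>a. (a, 0)) ` A))"
    using z by blast
qed

lemma regular_normal_cone_halfspaces:
  fixes q :: "'a::euclidean_space"
  assumes "finite G" "q \<in> halfspaces G"
  shows "regular_normal_cone (halfspaces G) q = convex_cone hull (active G q)"
  using assms
  by (simp add: regular_normal_cone_def tangent_cone_halfspaces negative_polar_halfspaces finite_active)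

lemma convex_halfspaces: "convex (halfspaces G)"
proof -
  have "halfspaces G = (\<Inter>p\<in>G. {q. fst p \<bullet> q \<le> snd p})"
    by (simp add: halfspaces_def set_eq_iff case_prod_beta)
  then show ?thesis by (simp add: convex_INT convex_halfspace_le)
qed

lemma limiting_normal_cone_halfspaces:
  fixes q :: "'a::euclidean_space"
  assumes "finite G" "q \<in> halfspaces G"
  shows "limiting_normal_cone (halfspaces G) q = convex_cone hull (active G q)"
  using convex_imp_clarke_regular[OF convex_halfspaces, of G q] regular_normal_cone_halfspaces[OF assms]
  by (simp add: clarke_regular_at_def)

lemma convex_cone_hull_insert_cases:
  assumes "\<eta> \<in> convex_cone hull (insert a A)"
  obtains n c where "n \<in> convex_cone hull A" "0 \<le> c" "\<eta> = n + c *\<^sub>R a"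
proof -
  let ?E = "{\<eta>. \<exists>n c. n \<in> convex_cone hull A \<and> 0 \<le> c \<and> \<eta> = n + c *\<^sub>R a}"
  have "convex_cone hull (insert a A) \<subseteq> ?E"
  proof (rule hull_minimal)
    have "a \<in> ?E"
      by (auto intro!: exI[of _ 0] exI[of _ "1::real"] convex_cone_hull_contains_0)
    moreover have "A \<subseteq> ?E"
      by (auto intro!: exI[of _ "0::real"] hull_inc)
    ultimately show "insert a A \<subseteq> ?E" by simp
    show "convex_cone ?E"
    proof (rule convex_cone_iff[THEN iffD2], intro conjI ballI allI impI)
      show "0 \<in> ?E" using convex_cone_hull_contains_0 by (auto intro!: exI[of _ 0])
    next
      fix x y assume "x \<in> ?E" "y \<in> ?E"
      then obtain n c n' c' where "n \<in> convex_cone hull A" "0 \<le> c" "x = n + c *\<^sub>R a"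
          "n' \<in> convex_cone hull A" "0 \<le> c'" "y = n' + c' *\<^sub>R a" by blast
      then show "x + y \<in> ?E"
        by (auto intro!: exI[of _ "n + n'"] exI[of _ "c + c'"] convex_cone_hull_add simp: algebra_simps)
    next
      fix x and k :: real assume "x \<in> ?E" "0 \<le> k"
      then obtain n c where "n \<in> convex_cone hull A" "0 \<le> c" "x = n + c *\<^sub>R a" by blast
      then show "k *\<^sub>R x \<in> ?E" using \<open>0 \<le> k\<close>
        by (auto intro!: exI[of _ "k *\<^sub>R n"] exI[of _ "k * c"] convex_cone_hull_mul simp: algebra_simps)
    qed
  qed
  then show thesis using assms that by blast
qed

text \<open>
  A constraint that is slack at \<open>q\<close> or has nonzero slope along \<open>w\<close> is not tight at \<open>q + t k *\<^sub>R ws k\<close> for large \<open>k\<close>. Hence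
  the normal cone of the set at these points is contained in the normal cone at \<open>w\<close> of its tangent cone at \<open>q\<close>.
\<close>

lemma active_from_direction:
  assumes G: "finite G" and q: "q \<in> halfspaces G"
    and t: "\<And>k. 0 < t k" "t \<longlonglongrightarrow> (0::real)" and ws: "ws \<longlonglongrightarrow> w"
  shows "eventually (\<lambda>k. active G (q + t k *\<^sub>R ws k) \<subseteq> {a \<in> active G q. a \<bullet> w = 0}) sequentially"
proof -
  have lim: "(\<lambda>k. a \<bullet> (q + t k *\<^sub>R ws k)) \<longlonglongrightarrow> a \<bullet> (q + 0 *\<^sub>R w)" for a
    by (intro tendsto_intros t ws)
  have "eventually (\<lambda>k. a \<bullet> (q + t k *\<^sub>R ws k) = b \<longrightarrow> a \<bullet> q = b \<and> a \<bullet> w = 0) sequentially"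
    if ab: "(a, b) \<in> G" for a b
  proof (cases "a \<bullet> q = b")
    case False
    then have "a \<bullet> (q + 0 *\<^sub>R w) < b" using q ab by (auto simp: halfspaces_def)
    from order_tendstoD(2)[OF lim this] show ?thesis by (rule eventually_mono) simp
  next
    case True
    show ?thesis
    proof (cases "a \<bullet> w = 0")
      case False
      have "eventually (\<lambda>k. a \<bullet> ws k \<noteq> 0) sequentially"
        by (rule tendsto_imp_eventually_ne[OF tendsto_inner[OF tendsto_const ws] False])
      then show ?thesis
      proof (rule eventually_mono)
        fix k assume "a \<bullet> ws k \<noteq> 0"
        then show "a \<bullet> (q + t k *\<^sub>R ws k) = b \<longrightarrow> a \<bullet> q = b \<and> a \<bullet> w = 0"
          using True t(1)[of k] by (simp add: inner_add_right)
      qed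
    qed (use True in simp)
  qed
  then have "eventually (\<lambda>k. \<forall>p\<in>G. fst p \<bullet> (q + t k *\<^sub>R ws k) = snd p \<longrightarrow>
      fst p \<bullet> q = snd p \<and> fst p \<bullet> w = 0) sequentially"
    by (intro eventually_ball_finite[OF G]) auto
  then show ?thesis by (rule eventually_mono) (force simp: active_def)
qed

section \<open>Multipliers of subregular constraint systems\<close>

text \<open>
  The multiplier map without coordinates: the transposed Jacobian is replaced by the adjoint of the
  derivative.
\<close>

definition multipliers ::
    "('a::euclidean_space \<Rightarrow> 'b::euclidean_space) \<Rightarrow> ('a \<Rightarrow> 'a \<Rightarrow>\<^sub>L 'b) \<Rightarrow> 'b set \<Rightarrow> 'a \<times> 'a \<Rightarrow> 'b set" where
  "multipliers \<phi> \<phi>' Q = (\<lambda>(z, z'). {\<mu> \<in> limiting_normal_cone Q (\<phi> z). adj (\<phi>' z) \<mu> = z'})"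

lemma mem_multipliers:
  "\<mu> \<in> multipliers \<phi> \<phi>' Q p \<longleftrightarrow>
     \<mu> \<in> limiting_normal_cone Q (\<phi> (fst p)) \<and> adj (\<phi>' (fst p)) \<mu> = snd p"
  by (cases p) (simp add: multipliers_def)

text \<open>
  Subregularity is fixed with modulus \<open>\<kappa>\<close> on the open set \<open>U\<close>, so that it provides the same bound at all
  points of \<open>U\<close>. The map \<open>H\<close> is the second derivative at the reference point.
\<close>

locale subregular_constraint =
  fixes \<phi> :: "'a::euclidean_space \<Rightarrow> 'b::euclidean_space"
    and \<phi>' :: "'a \<Rightarrow> 'a \<Rightarrow>\<^sub>L 'b"
    and H :: "'a \<Rightarrow>\<^sub>L 'a \<Rightarrow>\<^sub>L 'b"
    and Q :: "'b set" and x :: 'a and \<kappa> :: real and U :: "'a set"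
  assumes closed_Q: "closed Q"
    and der: "(\<phi> has_derivative blinfun_apply (\<phi>' z)) (at z)"
    and cont': "isCont \<phi>' z"
    and der2: "(\<phi>' has_derivative blinfun_apply H) (at x)"
    and feasible: "\<phi> x \<in> Q"
    and \<kappa>: "0 < \<kappa>" and U: "open U" "x \<in> U"
    and subregular: "z \<in> U \<Longrightarrow> infdist z (\<phi> -` Q) \<le> \<kappa> * infdist (\<phi> z) Q"
begin

lemma cont: "isCont \<phi> z"
  using der has_derivative_continuous by blast

lemma bounded_multiplier_exists:
  assumes z: "fst p \<in> U" and clarke: "clarke_regular_at Q (\<phi> (fst p))"
    and p: "p \<in> domain_of (multipliers \<phi> \<phi>' Q)"
  shows "\<exists>\<mu>\<in>multipliers \<phi> \<phi>' Q p. norm \<mu> \<le> \<kappa> * norm (snd p)"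
proof -
  obtain \<mu> where "\<mu> \<in> multipliers \<phi> \<phi>' Q p" using p by (auto simp: domain_of_def)
  then have "\<mu> \<in> regular_normal_cone Q (\<phi> (fst p))" "adj (\<phi>' (fst p)) \<mu> = snd p"
    using clarke by (simp_all add: mem_multipliers clarke_regular_at_def)
  then have "snd p \<in> regular_normal_cone (\<phi> -` Q) (fst p)"
    using regular_normal_preimage[OF der] by metis
  from bounded_multiplier[OF closed_Q clarke der cont' this \<kappa> U(1) z subregular]
  show ?thesis by (auto simp: mem_multipliers)
qed

text \<open>
  The bound \<open>\<kappa> * (norm xs + 1)\<close> depends only on the limit of the sequence. The uniform constant in
  \<open>multipliers_inner_calm_star_dir\<close> needs this.
\<close>

lemma convergent_multipliers:
  assumes clarke: "clarke_regular_near Q (\<phi> x)"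
    and ys: "ys \<longlonglongrightarrow> (x, xs)" "\<And>k. ys k \<in> domain_of (multipliers \<phi> \<phi>' Q)"
  obtains r \<mu> \<nu> where "strict_mono r" "\<And>j. \<mu> j \<in> multipliers \<phi> \<phi>' Q (ys (r j))"
    "\<And>j. norm (\<mu> j) \<le> \<kappa> * (norm xs + 1)" "\<mu> \<longlonglongrightarrow> \<nu>"
proof -
  have lim: "(\<lambda>k. fst (ys k)) \<longlonglongrightarrow> x" "(\<lambda>k. snd (ys k)) \<longlonglongrightarrow> xs"
    using tendsto_fst[OF ys(1)] tendsto_snd[OF ys(1)] by auto
  have in_Q: "\<phi> (fst (ys k)) \<in> Q" for k
    using ys(2)[of k] by (auto simp: domain_of_def mem_multipliers limiting_normal_cone_def)
  have "eventually (\<lambda>k. fst (ys k) \<in> U) sequentially"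
    using topological_tendstoD[OF lim(1) U] .
  moreover have "eventually (\<lambda>k. \<phi> (fst (ys k)) \<in> Q \<longrightarrow> clarke_regular_at Q (\<phi> (fst (ys k)))) sequentially"
    using isCont_tendsto_compose[OF cont lim(1)] clarke
    unfolding clarke_regular_near_def filterlim_iff by blast
  moreover have "eventually (\<lambda>k. norm (snd (ys k)) < norm xs + 1) sequentially"
    by (rule order_tendstoD(2)[OF tendsto_norm[OF lim(2)]]) simp
  ultimately have "eventually (\<lambda>k. \<exists>\<mu>\<in>multipliers \<phi> \<phi>' Q (ys k). norm \<mu> \<le> \<kappa> * (norm xs + 1)) sequentially"
  proof eventually_elim
    case (elim k)
    then obtain \<mu> where "\<mu> \<in> multipliers \<phi> \<phi>' Q (ys k)" "norm \<mu> \<le> \<kappa> * norm (snd (ys k))"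
      using bounded_multiplier_exists ys(2) in_Q by blast
    moreover have "\<kappa> * norm (snd (ys k)) \<le> \<kappa> * (norm xs + 1)"
      using elim \<kappa> by simp
    ultimately show ?case by (intro bexI[of _ \<mu>]) linarith+
  qed
  then obtain N where "\<And>k. k \<ge> N \<Longrightarrow> \<exists>\<mu>\<in>multipliers \<phi> \<phi>' Q (ys k). norm \<mu> \<le> \<kappa> * (norm xs + 1)"
    unfolding eventually_sequentially by blast
  then have "\<forall>k. \<exists>\<mu>\<in>multipliers \<phi> \<phi>' Q (ys (k + N)). norm \<mu> \<le> \<kappa> * (norm xs + 1)" by simp
  then obtain \<mu> where \<mu>: "\<And>k. \<mu> k \<in> multipliers \<phi> \<phi>' Q (ys (k + N))"
      "\<And>k. norm (\<mu> k) \<le> \<kappa> * (norm xs + 1)" by metis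
  have "\<forall>k. \<mu> k \<in> cball 0 (\<kappa> * (norm xs + 1))" using \<mu>(2) by simp
  then obtain \<nu> r where r: "strict_mono r" and \<nu>: "(\<mu> \<circ> r) \<longlonglongrightarrow> \<nu>"
    using compact_cball[of "0::'b"] unfolding compact_def by blast
  show thesis
  proof
    show "strict_mono (\<lambda>j. r j + N)" using r by (simp add: strict_mono_def)
    show "(\<lambda>j. \<mu> (r j)) \<longlonglongrightarrow> \<nu>" using \<nu> by (simp add: comp_def)
  qed (use \<mu> in auto)
qed

theorem multipliers_inner_semicompact:
  assumes "clarke_regular_near Q (\<phi> x)"
  shows "inner_semicompact (multipliers \<phi> \<phi>' Q) (x, xs) (domain_of (multipliers \<phi> \<phi>' Q))"
  unfolding inner_semicompact_def
  using convergent_multipliers[OF assms] by metis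

text \<open>
  The difference \<open>\<mu> j - \<nu>\<close> lies in the span \<open>L\<close>, on which the adjoint at \<open>x\<close> is bounded below by some
  \<open>e > 0\<close>. Its image under that adjoint is the difference of the second components of the points, which is at most
  their distance, minus \<open>adj (\<phi>' (z j) - \<phi>' x) (\<mu> j)\<close>, which the local Lipschitz bound for \<open>\<phi>'\<close> and the bound
  on the multipliers control.
\<close>

theorem multipliers_inner_calm_star_dir:
  assumes Q: "polyhedron Q"
    and nondeg: "\<And>\<mu>. adj (\<phi>' x) \<mu> = 0 \<Longrightarrow>
        \<mu> \<in> span (limiting_normal_cone (tangent_cone Q (\<phi> x)) (\<phi>' x u)) \<Longrightarrow> \<mu> = 0"
  shows "inner_calm_star_dir (multipliers \<phi> \<phi>' Q) (x, xs) (u, us) (domain_of (multipliers \<phi> \<phi>' Q))"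
proof -
  obtain G where G: "finite G" "Q = halfspaces G" using polyhedron_halfspaces[OF Q] .
  define L where "L = span (limiting_normal_cone (tangent_cone Q (\<phi> x)) (\<phi>' x u))"
  have "bounded_linear (adj (\<phi>' x))" by (rule adj.bounded_linear_right)
  then obtain e where e: "0 < e" "\<And>\<mu>. \<mu> \<in> L \<Longrightarrow> e * norm \<mu> \<le> norm (adj (\<phi>' x) \<mu>)"
    using injective_imp_isometric[of L "adj (\<phi>' x)"] nondeg
    unfolding L_def by (metis closed_span subspace_span)
  define lip where "lip = norm H + 1"
  obtain d where d: "0 < d" "\<And>z. norm (z - x) < d \<Longrightarrow> norm (\<phi>' z - \<phi>' x) \<le> lip * norm (z - x)"
  proof -
    obtain d where d: "0 < d" "\<And>z. norm (z - x) < d \<Longrightarrow>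
        norm (\<phi>' z - \<phi>' x - H (z - x)) \<le> 1 * norm (z - x)"
      using der2 unfolding has_derivative_at_alt by (meson zero_less_one)
    have "norm (\<phi>' z - \<phi>' x) \<le> lip * norm (z - x)" if "norm (z - x) < d" for z
      using norm_triangle_ineq[of "\<phi>' z - \<phi>' x - H (z - x)" "H (z - x)"] d(2)[OF that]
        norm_blinfun[of H "z - x"] by (simp add: lip_def algebra_simps)
    then show thesis using that d(1) by blast
  qed
  define B where "B = \<kappa> * (norm xs + 1)"
  have B: "0 < B" using \<kappa> by (auto simp: B_def add_nonneg_pos)
  define c where "c = (1 + lip * B) / e"
  have lip: "0 < lip" by (simp add: lip_def add_nonneg_pos)
  have c: "0 < c" using B e lip by (simp add: c_def add_pos_pos)
  have "\<exists>r \<mu> \<nu>. strict_mono (r::nat \<Rightarrow> nat) \<and> (\<forall>j. \<mu> j \<in> multipliers \<phi> \<phi>' Q (ys (r j)) \<and>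
      norm (\<mu> j - \<nu>) \<le> c * norm (ys (r j) - (x, xs)))"
    if dir: "converges_from_direction ys (x, xs) (u, us)"
      and dom: "\<forall>k. ys k \<in> domain_of (multipliers \<phi> \<phi>' Q)" for ys
  proof -
    obtain r \<mu> \<nu> where r: "strict_mono r" and \<mu>: "\<And>j. \<mu> j \<in> multipliers \<phi> \<phi>' Q (ys (r j))"
        "\<And>j. norm (\<mu> j) \<le> B" and \<nu>: "\<mu> \<longlonglongrightarrow> \<nu>"
      using convergent_multipliers[OF convex_imp_clarke_regular_near[OF polyhedron_imp_convex[OF Q]] converges_from_direction_lim[OF dir]] dom
      unfolding B_def by metis
    obtain t vs where t: "\<And>k. 0 < t k" "t \<longlonglongrightarrow> (0::real)" and vs: "vs \<longlonglongrightarrow> (u, us)"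
        and ys: "\<And>k. ys k = (x, xs) + t k *\<^sub>R vs k"
      using dir unfolding converges_from_direction_def by blast
    define z where "z j = fst (ys (r j))" for j
    define w where "w j = (1 / t (r j)) *\<^sub>R (\<phi> (x + t (r j) *\<^sub>R fst (vs (r j))) - \<phi> x)" for j
    have tr: "(\<lambda>j. t (r j)) \<longlonglongrightarrow> 0" and vr: "(\<lambda>j. vs (r j)) \<longlonglongrightarrow> (u, us)"
      using LIMSEQ_subseq_LIMSEQ[OF _ r] t(2) vs by (auto simp: comp_def)
    have z: "z j = x + t (r j) *\<^sub>R fst (vs (r j))" for j by (simp add: z_def ys)
    have w: "w \<longlonglongrightarrow> \<phi>' x u"
      unfolding w_def using has_derivative_along_sequence[OF der t(1) tr tendsto_fst[OF vr]] by simp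
    have \<phi>z: "\<phi> (z j) = \<phi> x + t (r j) *\<^sub>R w j" for j
      using t(1)[of "r j"] by (simp add: w_def z)
    have zQ: "\<phi> (z j) \<in> Q" and \<mu>N: "\<mu> j \<in> limiting_normal_cone Q (\<phi> (z j))"
      and \<mu>A: "adj (\<phi>' (z j)) (\<mu> j) = snd (ys (r j))" for j
      using \<mu>(1)[of j] by (auto simp: z_def mem_multipliers limiting_normal_cone_def)
    have "\<phi>' x u \<in> tangent_cone Q (\<phi> x)"
      by (rule tangent_coneI[OF feasible t(1) tr w zQ[unfolded \<phi>z]])
    then have wT: "\<phi>' x u \<in> halfspaces ((\<lambda>a. (a, 0)) ` active G (\<phi> x))"
      and T: "tangent_cone Q (\<phi> x) = halfspaces ((\<lambda>a. (a, 0)) ` active G (\<phi> x))"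
      using tangent_cone_halfspaces[OF G(1)] feasible unfolding G(2) by auto
    have "convex_cone hull {a \<in> active G (\<phi> x). a \<bullet> \<phi>' x u = 0}
        = regular_normal_cone (tangent_cone Q (\<phi> x)) (\<phi>' x u)"
      unfolding T using regular_normal_cone_halfspaces[OF finite_imageI[OF finite_active[OF G(1)]] wT]
      by (simp add: active_halfspaces_cone)
    also have "\<dots> \<subseteq> limiting_normal_cone (tangent_cone Q (\<phi> x)) (\<phi>' x u)"
      by (rule regular_normal_subset_limiting)
    also have "\<dots> \<subseteq> L"
      unfolding L_def by (rule span_superset)
    finally have hull_L: "convex_cone hull {a \<in> active G (\<phi> x). a \<bullet> \<phi>' x u = 0} \<subseteq> L" .
    have "eventually (\<lambda>j. active G (\<phi> (z j)) \<subseteq> {a \<in> active G (\<phi> x). a \<bullet> \<phi>' x u = 0}) sequentially"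
      unfolding \<phi>z using active_from_direction[OF G(1) _ t(1) tr w] feasible G(2) by blast
    then have "eventually (\<lambda>j. \<mu> j \<in> L) sequentially"
    proof eventually_elim
      case (elim j)
      have "\<mu> j \<in> convex_cone hull (active G (\<phi> (z j)))"
        using \<mu>N[of j] limiting_normal_cone_halfspaces[OF G(1) zQ[unfolded G(2)]] by (simp add: G(2))
      then show ?case using hull_mono[OF elim, of convex_cone] hull_L by blast
    qed
    moreover have zlim: "z \<longlonglongrightarrow> x"
      unfolding z_def using LIMSEQ_subseq_LIMSEQ[OF tendsto_fst[OF converges_from_direction_lim[OF dir]] r]
      by (simp add: comp_def)
    then have "eventually (\<lambda>j. norm (z j - x) < d) sequentially"
      using tendstoD[OF zlim d(1)] by (simp add: dist_norm)
    ultimately have "eventually (\<lambda>j. \<mu> j \<in> L \<and> norm (z j - x) < d) sequentially"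
      by (rule eventually_conj)
    then obtain N where N: "\<And>j. j \<ge> N \<Longrightarrow> \<mu> j \<in> L \<and> norm (z j - x) < d"
      unfolding eventually_sequentially by blast
    have "\<nu> \<in> L"
      by (rule closed_sequentially[OF _ _ LIMSEQ_ignore_initial_segment[OF \<nu>, of N]])
        (use N in \<open>auto simp: L_def closed_span\<close>)
    have "(\<lambda>j. adj (\<phi>' (z j)) (\<mu> j)) \<longlonglongrightarrow> adj (\<phi>' x) \<nu>"
      by (intro adj.tendsto \<nu> isCont_tendsto_compose[OF cont' zlim])
    moreover have "(\<lambda>j. adj (\<phi>' (z j)) (\<mu> j)) \<longlonglongrightarrow> xs"
      unfolding \<mu>A using LIMSEQ_subseq_LIMSEQ[OF tendsto_snd[OF converges_from_direction_lim[OF dir]] r]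
      by (simp add: comp_def)
    ultimately have \<nu>A: "adj (\<phi>' x) \<nu> = xs" by (rule LIMSEQ_unique)
    have est: "norm (\<mu> j - \<nu>) \<le> c * norm (ys (r j) - (x, xs))" if j: "j \<ge> N" for j
    proof -
      let ?n = "norm (ys (r j) - (x, xs))"
      have n: "norm (z j - x) \<le> ?n" "norm (snd (ys (r j)) - xs) \<le> ?n"
        using norm_fst_le[of "fst (ys (r j) - (x, xs))" "snd (ys (r j) - (x, xs))"]
          norm_snd_le[of "snd (ys (r j) - (x, xs))" "fst (ys (r j) - (x, xs))"]
        unfolding prod.collapse by (simp_all add: z_def)
      have "\<mu> j - \<nu> \<in> L" using N[OF j] \<open>\<nu> \<in> L\<close> by (simp add: L_def span_diff)
      then have "e * norm (\<mu> j - \<nu>) \<le> norm (adj (\<phi>' x) (\<mu> j - \<nu>))" by (rule e)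
      also have "adj (\<phi>' x) (\<mu> j - \<nu>) = (snd (ys (r j)) - xs) - adj (\<phi>' (z j) - \<phi>' x) (\<mu> j)"
        by (simp add: adj.diff_left adj.diff_right \<mu>A \<nu>A)
      also have "norm \<dots> \<le> norm (snd (ys (r j)) - xs) + norm (adj (\<phi>' (z j) - \<phi>' x) (\<mu> j))"
        by (rule norm_triangle_ineq4)
      also have "norm (adj (\<phi>' (z j) - \<phi>' x) (\<mu> j)) \<le> norm (\<phi>' (z j) - \<phi>' x) * norm (\<mu> j)"
        by (rule norm_adj_le)
      also have "\<dots> \<le> (lip * ?n) * B"
        using d(2)[of "z j"] N[OF j] n(1) \<mu>(2)[of j] lip
        by (intro mult_mono) (auto intro: order_trans[OF _ mult_left_mono])
      finally have "e * norm (\<mu> j - \<nu>) \<le> (1 + lip * B) * ?n" using n(2) by (simp add: algebra_simps)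
      then show ?thesis using e(1) by (simp add: c_def field_simps)
    qed
    show ?thesis
      by (intro exI[of _ "\<lambda>j. r (j + N)"] exI[of _ "\<lambda>j. \<mu> (j + N)"] exI[of _ \<nu>])
        (use r \<mu>(1) est in \<open>auto simp: strict_mono_def\<close>)
  qed
  then show ?thesis unfolding inner_calm_star_dir_def using c by blast
qed

text \<open>
  Along a subsequence the normal cone is one fixed cone, generated by \<open>J\<close>. The cone \<open>D\<close> consists of the directions from \<open>\<nu>\<close>
  that stay in this cone for a short time. The new points keep the first components \<open>z i\<close>, so
  their normal cone is unchanged, and only their second components are adapted to the new multipliers \<open>\<nu> + t i *\<^sub>R \<xi>\<close>.
\<close>

theorem multipliers_inner_calm_star_fuzzy:
  assumes Q: "polyhedron Q"
  shows "inner_calm_star_fuzzy (multipliers \<phi> \<phi>' Q) (x, xs) (domain_of (multipliers \<phi> \<phi>' Q))"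
  unfolding inner_calm_star_fuzzy_def
proof (intro allI impI)
  fix v :: "'a \<times> 'a" assume nv: "norm v = 1"
  let ?D = "domain_of (multipliers \<phi> \<phi>' Q)"
  obtain G where G: "finite G" "Q = halfspaces G" using polyhedron_halfspaces[OF Q] .
  show "inner_calm_star_fuzzy_dir (multipliers \<phi> \<phi>' Q) (x, xs) v ?D"
  proof (cases "v \<in> tangent_cone ?D (x, xs)")
    case False then show ?thesis by (simp add: inner_calm_star_fuzzy_dir_def)
  next
    case True
    then obtain t0 vs0 where t0: "\<And>k. 0 < t0 k" "t0 \<longlonglongrightarrow> (0::real)" and vs0: "vs0 \<longlonglongrightarrow> v"
        and dom: "\<And>k::nat. (x, xs) + t0 k *\<^sub>R vs0 k \<in> ?D"
      unfolding tangent_cone_def by blast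
    define ys where "ys k = (x, xs) + t0 k *\<^sub>R vs0 k" for k
    have dir: "converges_from_direction ys (x, xs) v"
      unfolding converges_from_direction_def ys_def using t0 vs0 by blast
    obtain r \<mu>0 \<nu> where r: "strict_mono r" and \<mu>0: "\<And>j. \<mu>0 j \<in> multipliers \<phi> \<phi>' Q (ys (r j))"
        and \<nu>0: "\<mu>0 \<longlonglongrightarrow> \<nu>"
      using convergent_multipliers[OF convex_imp_clarke_regular_near[OF polyhedron_imp_convex[OF Q]] converges_from_direction_lim[OF dir]] dom
      unfolding ys_def by metis
    have "range (\<lambda>j. active G (\<phi> (fst (ys (r j))))) \<subseteq> Pow (fst ` G)"
      by (force simp: active_def)
    then have "finite (range (\<lambda>j. active G (\<phi> (fst (ys (r j))))))"
      using G(1) finite_subset by blast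
    then obtain j0 where "infinite {j. active G (\<phi> (fst (ys (r j)))) = active G (\<phi> (fst (ys (r j0))))}"
      using pigeonhole_infinite[OF infinite_UNIV_nat] by auto
    then obtain s :: "nat \<Rightarrow> nat" where s: "strict_mono s"
        and "\<forall>i. s i \<in> {j. active G (\<phi> (fst (ys (r j)))) = active G (\<phi> (fst (ys (r j0))))}"
      using infinite_enumerate by blast
    then obtain J where J: "\<And>i. active G (\<phi> (fst (ys (r (s i))))) = J" by blast
    have rs: "strict_mono (\<lambda>i. r (s i))" using r s by (simp add: strict_mono_def)
    define t z us \<mu> where "t i = t0 (r (s i))" and "z i = fst (ys (r (s i)))"
      and "us i = vs0 (r (s i))" and "\<mu> i = \<mu>0 (s i)" for i
    have t: "\<And>i. 0 < t i" "t \<longlonglongrightarrow> 0" and us: "us \<longlonglongrightarrow> v" and \<nu>: "\<mu> \<longlonglongrightarrow> \<nu>"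
      using t0 LIMSEQ_subseq_LIMSEQ[OF t0(2) rs] LIMSEQ_subseq_LIMSEQ[OF vs0 rs]
        LIMSEQ_subseq_LIMSEQ[OF \<nu>0 s] unfolding t_def us_def \<mu>_def comp_def by auto
    have z: "z i = x + t i *\<^sub>R fst (us i)" for i by (simp add: z_def ys_def t_def us_def)
    have "(\<lambda>i. x + t i *\<^sub>R fst (us i)) \<longlonglongrightarrow> x + 0 *\<^sub>R fst v"
      by (intro tendsto_intros t us)
    then have zlim: "z \<longlonglongrightarrow> x" unfolding z[symmetric] by simp
    have zQ: "\<phi> (z i) \<in> Q" and \<mu>N: "\<mu> i \<in> limiting_normal_cone Q (\<phi> (z i))"
      and \<mu>A: "adj (\<phi>' (z i)) (\<mu> i) = xs + t i *\<^sub>R snd (us i)" for i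
      using \<mu>0[of "s i"]
      by (auto simp: z_def \<mu>_def us_def t_def ys_def mem_multipliers limiting_normal_cone_def)
    have finJ: "finite J" using J[of 0] finite_active[OF G(1)] by metis
    have N: "limiting_normal_cone Q (\<phi> (z i)) = convex_cone hull J" for i
      using limiting_normal_cone_halfspaces[OF G(1) zQ[unfolded G(2)], of i] J by (simp add: z_def G(2))
    have \<nu>N: "\<nu> \<in> convex_cone hull J"
      by (rule closed_sequentially[OF closed_convex_cone_hull[OF finJ] _ \<nu>]) (use \<mu>N N in auto)
    have "(\<lambda>i. adj (\<phi>' (z i)) (\<mu> i)) \<longlonglongrightarrow> adj (\<phi>' x) \<nu>"
      by (intro adj.tendsto \<nu> isCont_tendsto_compose[OF cont' zlim])
    moreover have "(\<lambda>i. adj (\<phi>' (z i)) (\<mu> i)) \<longlonglongrightarrow> xs"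
      using tendsto_add[OF tendsto_const tendsto_scaleR[OF t(2) tendsto_snd[OF us]], of xs] by (simp add: \<mu>A)
    ultimately have \<nu>A: "adj (\<phi>' x) \<nu> = xs" by (rule LIMSEQ_unique)
    define B where "B i = (1 / t i) *\<^sub>R (\<phi>' (z i) - \<phi>' x)" for i
    have Blim: "B \<longlonglongrightarrow> H (fst v)"
      unfolding B_def z by (rule has_derivative_along_sequence[OF der2 t tendsto_fst[OF us]])
    have \<phi>'z: "\<phi>' (z i) = \<phi>' x + t i *\<^sub>R B i" for i
      using t(1)[of i] by (simp add: B_def)
    define D where "D = convex_cone hull (insert (- \<nu>) J)"
    have "(1 / t i) *\<^sub>R (\<mu> i - \<nu>) \<in> D" for i
    proof -
      have "\<mu> i \<in> D" using \<mu>N[of i] hull_mono[of J "insert (- \<nu>) J" convex_cone] by (auto simp: N D_def)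
      moreover have "- \<nu> \<in> D" by (simp add: D_def hull_inc)
      ultimately have "\<mu> i + - \<nu> \<in> D" unfolding D_def by (rule convex_cone_hull_add)
      then show ?thesis unfolding D_def using t(1)[of i] by (intro convex_cone_hull_mul) auto
    qed
    moreover have "adj (\<phi>' x) ((1 / t i) *\<^sub>R (\<mu> i - \<nu>)) = snd (us i) - adj (B i) (\<mu> i)" for i
    proof -
      have "adj (\<phi>' x) (\<mu> i - \<nu>) = t i *\<^sub>R (snd (us i) - adj (B i) (\<mu> i))"
        using \<mu>A[of i] \<nu>A
        by (simp add: \<phi>'z adj.add_left adj.scaleR_left adj.diff_right algebra_simps)
      then show ?thesis using t(1)[of i] by (simp add: adj.scaleR_right)
    qed
    ultimately have image: "snd (us i) - adj (B i) (\<mu> i) \<in> adj (\<phi>' x) ` D" for i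
      by (metis image_eqI)
    have lin: "linear (adj (\<phi>' x))"
      using adj.bounded_linear_right bounded_linear.linear by blast
    have closed: "closed (adj (\<phi>' x) ` D)"
      unfolding D_def convex_cone_hull_linear_image[OF lin, symmetric]
      using finJ by (intro closed_convex_cone_hull) simp
    \<comment> \<open>The images of the quotients converge although the quotients themselves may be unbounded. A
      finitely generated cone has a closed linear image, so the limit has a preimage in \<open>D\<close>.\<close>
    have "(\<lambda>i. snd (us i) - adj (B i) (\<mu> i)) \<longlonglongrightarrow> snd v - adj (H (fst v)) \<nu>"
      by (intro tendsto_intros us adj.tendsto Blim \<nu>)
    then have "snd v - adj (H (fst v)) \<nu> \<in> adj (\<phi>' x) ` D"
      by (rule closed_sequentially[OF closed image])
    then obtain \<xi> where \<xi>: "\<xi> \<in> D" "adj (\<phi>' x) \<xi> = snd v - adj (H (fst v)) \<nu>" by auto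
    obtain n c where n: "n \<in> convex_cone hull J" "0 \<le> c" "\<xi> = n + c *\<^sub>R (- \<nu>)"
      using convex_cone_hull_insert_cases[OF \<xi>(1)[unfolded D_def]] by blast
    have mem: "\<nu> + t i *\<^sub>R \<xi> \<in> convex_cone hull J" if "t i * c \<le> 1" for i
    proof -
      have "\<nu> + t i *\<^sub>R \<xi> = (1 - t i * c) *\<^sub>R \<nu> + t i *\<^sub>R n" by (simp add: n algebra_simps)
      then show ?thesis
        using that t(1)[of i] \<nu>N n(1) by (simp add: convex_cone_hull_add convex_cone_hull_mul)
    qed
    define vs where "vs i = (fst (us i), adj (B i) \<nu> + adj (\<phi>' (z i)) \<xi>)" for i
    have "vs \<longlonglongrightarrow> (fst v, adj (H (fst v)) \<nu> + adj (\<phi>' x) \<xi>)"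
      unfolding vs_def
      by (intro tendsto_intros us adj.tendsto Blim isCont_tendsto_compose[OF cont' zlim])
    then have vs: "vs \<longlonglongrightarrow> v" by (simp add: \<xi>(2))
    \<comment> \<open>The equation for \<open>\<xi>\<close> was chosen so that these points leave \<open>(x, xs)\<close> in direction \<open>v\<close>.\<close>
    have ys': "(z i, adj (\<phi>' (z i)) (\<nu> + t i *\<^sub>R \<xi>)) = (x, xs) + t i *\<^sub>R vs i" for i
    proof -
      have "adj (\<phi>' (z i)) \<nu> = xs + t i *\<^sub>R adj (B i) \<nu>"
        unfolding \<phi>'z by (simp add: adj.add_left adj.scaleR_left \<nu>A)
      then show ?thesis
        by (simp add: z vs_def adj.add_right adj.scaleR_right scaleR_add_right)
    qed
    have "eventually (\<lambda>i. t i * c < 1) sequentially"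
      using order_tendstoD(2)[OF tendsto_mult[OF t(2) tendsto_const[of c]], of 1] by simp
    moreover have "eventually (\<lambda>i. 1/2 < norm (vs i)) sequentially"
      using order_tendstoD(1)[OF tendsto_norm[OF vs], of "1/2"] nv by simp
    ultimately have "eventually (\<lambda>i. t i * c < 1 \<and> 1/2 < norm (vs i)) sequentially"
      by (rule eventually_conj)
    then obtain M where M: "\<And>i. i \<ge> M \<Longrightarrow> t i * c < 1 \<and> 1/2 < norm (vs i)"
      unfolding eventually_sequentially by blast
    \<comment> \<open>Since \<open>norm (vs i) > 1/2\<close>, the distance to \<open>(x, xs)\<close> is more than \<open>t i / 2\<close>.\<close>
    have est: "norm (t i *\<^sub>R \<xi>) \<le> (2 * norm \<xi> + 1) * norm (t i *\<^sub>R vs i)" if "i \<ge> M" for i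
    proof -
      have "norm \<xi> * 1 \<le> (2 * norm \<xi> + 1) * norm (vs i)"
        using M[OF that] mult_mono[of "2 * norm \<xi>" "2 * norm \<xi> + 1" "1/2" "norm (vs i)"] by simp
      then have "t i * norm \<xi> \<le> t i * ((2 * norm \<xi> + 1) * norm (vs i))"
        using t(1)[of i] by simp
      then show ?thesis
        using t(1)[of i] by (simp add: mult.left_commute)
    qed
    have mult: "\<nu> + t i *\<^sub>R \<xi> \<in> multipliers \<phi> \<phi>' Q ((x, xs) + t i *\<^sub>R vs i)" if "i \<ge> M" for i
      using mem[of i] M[OF that] unfolding ys'[symmetric] by (simp add: mem_multipliers N)
    have "converges_from_direction (\<lambda>i. (x, xs) + t (i + M) *\<^sub>R vs (i + M)) (x, xs) v"
      unfolding converges_from_direction_def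
      by (intro exI[of _ "\<lambda>i. t (i + M)"] exI[of _ "\<lambda>i. vs (i + M)"] conjI allI t(1) refl
          LIMSEQ_ignore_initial_segment[OF t(2)] LIMSEQ_ignore_initial_segment[OF vs])
    moreover have "(x, xs) + t (i + M) *\<^sub>R vs (i + M) \<in> ?D \<and>
        \<nu> + t (i + M) *\<^sub>R \<xi> \<in> multipliers \<phi> \<phi>' Q ((x, xs) + t (i + M) *\<^sub>R vs (i + M)) \<and>
        norm (\<nu> + t (i + M) *\<^sub>R \<xi> - \<nu>) \<le>
          (2 * norm \<xi> + 1) * norm ((x, xs) + t (i + M) *\<^sub>R vs (i + M) - (x, xs))" for i
      using mult[of "i + M"] est[of "i + M"] by (auto simp: domain_of_def)
    moreover have "0 < 2 * norm \<xi> + 1" by (simp add: add_nonneg_pos)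
    ultimately show ?thesis
      unfolding inner_calm_star_fuzzy_dir_def
      by (intro disjI2 exI[of _ "2 * norm \<xi> + 1"]
          exI[of _ "\<lambda>i. (x, xs) + t (i + M) *\<^sub>R vs (i + M)"]
          exI[of _ "\<lambda>i. \<nu> + t (i + M) *\<^sub>R \<xi>"] exI[of _ \<nu>] conjI allI) simp_all
  qed
qed

end

section \<open>The theorem in coordinates\<close>

lemma transpose_jacobian:
  fixes \<phi> :: "real^'n \<Rightarrow> real^'m"
  assumes "(\<phi> has_derivative blinfun_apply L) (at x)"
  shows "jacobian \<phi> (at x) *v h = L h" "transpose (jacobian \<phi> (at x)) *v \<mu> = adj L \<mu>"
proof -
  have "(\<phi> has_derivative (*v) (jacobian \<phi> (at x))) (at x)"
    using assms jacobian_works differentiable_def by blast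
  then have "blinfun_apply L = (*v) (jacobian \<phi> (at x))"
    using assms has_derivative_unique by blast
  then show "jacobian \<phi> (at x) *v h = L h" "transpose (jacobian \<phi> (at x)) *v \<mu> = adj L \<mu>"
    by (simp_all add: adjoint_matrix)
qed

theorem theorem3p9:
  fixes Q :: "(real^'m) set"
    and \<phi> :: "real^'n \<Rightarrow> real^'m"
    and x xstar :: "real^'n"
  assumes "closed Q"
    and "twice_continuously_differentiable \<phi>"
    and "(x, xstar) \<in> graph_of (limiting_normal_cone (\<phi> -` Q))"
    and "metrically_subregular (constraint_mapping \<phi> Q) x 0"
  shows "(clarke_regular_near Q (\<phi> x) \<longrightarrow>
            inner_semicompact (multiplier_map \<phi> Q) (x, xstar) (domain_of (multiplier_map \<phi> Q)))
       \<and> (convex Q \<longrightarrow> clarke_regular_near Q (\<phi> x))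
       \<and> (polyhedron Q \<longrightarrow>
            inner_calm_star_fuzzy (multiplier_map \<phi> Q) (x, xstar)
              (domain_of (multiplier_map \<phi> Q)))
       \<and> (\<forall>u ustar :: real^'n.
            norm (u, ustar) = 1 \<and> polyhedron Q \<and>
            (\<forall>\<mu>. transpose (jacobian \<phi> (at x)) *v \<mu> = 0 \<and>
                 \<mu> \<in> span (limiting_normal_cone (tangent_cone Q (\<phi> x)) (jacobian \<phi> (at x) *v u))
                 \<longrightarrow> \<mu> = 0) \<longrightarrow>
            inner_calm_star_dir (multiplier_map \<phi> Q) (x, xstar) (u, ustar)
              (domain_of (multiplier_map \<phi> Q)))"
proof -
  obtain \<phi>' :: "real^'n \<Rightarrow> (real^'n) \<Rightarrow>\<^sub>L (real^'m)" and \<phi>'' where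
    d1: "\<And>z. (\<phi> has_derivative blinfun_apply (\<phi>' z)) (at z)" and
    d2: "\<And>z. (\<phi>' has_derivative blinfun_apply (\<phi>'' z)) (at z)"
    using assms(2) unfolding twice_continuously_differentiable_def by blast
  have feasible: "\<phi> x \<in> Q"
    using assms(3) by (auto simp: graph_of_def limiting_normal_cone_def)
  obtain \<kappa> U where \<kappa>: "0 < \<kappa>" and U: "open U" "x \<in> U"
    and sub: "\<And>z. z \<in> U \<Longrightarrow> constraint_mapping \<phi> Q z \<noteq> {} \<Longrightarrow>
      infdist z {z. 0 \<in> constraint_mapping \<phi> Q z} \<le> \<kappa> * infdist 0 (constraint_mapping \<phi> Q z)"
    using assms(4) unfolding metrically_subregular_def by blast
  have pre: "{z. 0 \<in> constraint_mapping \<phi> Q z} = \<phi> -` Q"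
    by (auto simp: constraint_mapping_def)
  have dist: "infdist 0 (constraint_mapping \<phi> Q z) = infdist (\<phi> z) Q" for z
  proof -
    have "constraint_mapping \<phi> Q z = (\<lambda>q. \<phi> z - q) ` Q"
      by (auto simp: constraint_mapping_def)
    then show ?thesis
      using feasible by (simp add: infdist_def image_image dist_norm norm_minus_commute)
  qed
  interpret subregular_constraint \<phi> \<phi>' "\<phi>'' x" Q x \<kappa> U
  proof
    show "isCont \<phi>' z" for z using d2 has_derivative_continuous by blast
    show "infdist z (\<phi> -` Q) \<le> \<kappa> * infdist (\<phi> z) Q" if "z \<in> U" for z
      using sub[OF that] feasible unfolding pre dist by (auto simp: constraint_mapping_def)
  qed (fact assms(1) d1 d2 feasible \<kappa> U)+
  have eq: "multiplier_map \<phi> Q = multipliers \<phi> \<phi>' Q"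
    unfolding multiplier_map_def multipliers_def transpose_jacobian(2)[OF d1] ..
  show ?thesis
    unfolding eq transpose_jacobian[OF d1]
    using multipliers_inner_semicompact multipliers_inner_calm_star_fuzzy
      multipliers_inner_calm_star_dir convex_imp_clarke_regular_near
    by auto
qed

end
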